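(* Let $p$ be a prime, $k \in \mathbb{N}$, $q = p^k$, $m \in \mathbb{N}$ and $c_1,\dots,c_m \in \mathbb{N}$. Then the set $B(q; c_1,\dots,c_m; 1,\dots,1) = \{ \sum_{j=1}^m c_j q^{n_j} : n_1,\dots,n_m \in \mathbb{N}_0\}$ is an $\overline{\mathbb{F}_p}(t)$-DML set over split torus.
   Context: For a field $K$ and a quasi-projective variety $X$ over $K$, a set $S \subseteq \mathbb{N}_0$ is a $K$-DML set over $X$ if there exist an endomorphism $\Phi$ of $X$ (a morphism $X \to X$ defined over $K$), a point $\alpha \in X(K)$ and a closed subvariety $V \subseteq X$ defined over $K$ (not necessarily irreducible) such that $S = \{ n \in \mathbb{N}_0 : \Phi^n(\alpha) \in V(K)\}$. $S$ is a $K$-DML set over split torus if it is a $K$-DML set over $\mathbb{G}_m^k$ for some $k \in \mathbb{N}$. $\mathbb{N}$ denotes the positive integers and $\mathbb{N}_0 = \mathbb{N}\cup\{0\}$. *)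

theory Defs
  imports "HOL-Computational_Algebra.Computational_Algebra"
begin

definition torus_pts :: "nat \<Rightarrow> 'k::field list set" where
  "torus_pts k = {x. length x = k \<and> (\<forall>i<k. x ! i \<noteq> 0)}"

definition laurent_mono :: "int list \<Rightarrow> 'k::field list \<Rightarrow> 'k" where
  "laurent_mono e x = (\<Prod>i<length x. (x ! i) powi (e ! i))"

text \<open>Regular functions on G_m^k over K: functions on the K-points given by a Laurent
  polynomial in k variables with coefficients in K.\<close>
definition laurent_fun :: "nat \<Rightarrow> ('k::field list \<Rightarrow> 'k) \<Rightarrow> bool" where
  "laurent_fun k f \<longleftrightarrow> (\<exists>E a. finite E \<and> (\<forall>e\<in>E. length e = k) \<and>
      (\<forall>x\<in>torus_pts k. f x = (\<Sum>e\<in>E. a e * laurent_mono e x)))"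

text \<open>Endomorphisms of G_m^k over K: each coordinate is a regular function which is a unit
  in the coordinate ring (its inverse is again a Laurent polynomial).\<close>
definition torus_endo :: "nat \<Rightarrow> ('k::field list \<Rightarrow> 'k list) \<Rightarrow> bool" where
  "torus_endo k \<Phi> \<longleftrightarrow> (\<forall>x\<in>torus_pts k. length (\<Phi> x) = k) \<and>
     (\<forall>i<k. \<exists>f g. laurent_fun k f \<and> laurent_fun k g \<and>
        (\<forall>x\<in>torus_pts k. \<Phi> x ! i = f x \<and> f x * g x = 1))"

text \<open>K-points V(K) of a closed subvariety V of G_m^k defined over K: common zeros in the torus
  of finitely many Laurent polynomials over K.\<close>
definition torus_closed :: "nat \<Rightarrow> 'k::field list set \<Rightarrow> bool" where
  "torus_closed k V \<longleftrightarrow> (\<exists>F. finite F \<and> (\<forall>f\<in>F. laurent_fun k f) \<and>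
      V = {x\<in>torus_pts k. \<forall>f\<in>F. f x = 0})"

definition dml_torus :: "'k::field itself \<Rightarrow> nat \<Rightarrow> nat set \<Rightarrow> bool" where
  "dml_torus _ k S \<longleftrightarrow> (\<exists>(\<Phi>::'k list \<Rightarrow> 'k list) \<alpha> V.
      torus_endo k \<Phi> \<and> \<alpha> \<in> torus_pts k \<and> torus_closed k V \<and>
      S = {n. (\<Phi> ^^ n) \<alpha> \<in> V})"

definition dml_split_torus :: "'k::field itself \<Rightarrow> nat set \<Rightarrow> bool" where
  "dml_split_torus K S \<longleftrightarrow> (\<exists>k\<ge>1. dml_torus K k S)"

end

theory Submission
  imports Defs
begin

text \<open>
  Write \<open>t\<close> for the indeterminate and \<open>Q\<close> for a power of \<open>p\<close>. It suffices to describe the given set as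
  the zero set of a single sequence built by sums and products from periodic sequences and powers
  \<open>n \<mapsto> g ^ n\<close>, because translations and cyclic permutations of tori produce such sequences.

  If \<open>n\<close> is a sum of \<open>C < Q\<close> powers \<open>Q ^ a\<close>, then \<open>f(t) ^ n\<close> is the product of the \<open>f(t ^ Q ^ a)\<close> for every
  polynomial \<open>f\<close> over the field with \<open>Q\<close> elements. For \<open>f = t + x\<close> this is a monic polynomial of degree
  \<open>C\<close> in \<open>x\<close>, and conversely this degree condition, a linear condition on the \<open>(t + x) ^ n\<close>, bounds the
  base-\<open>Q\<close> digit sum of \<open>n\<close>. Interpolating in the coefficients of \<open>f\<close> shows that the norm over the digits
  of any polynomial is again a sequence of the above kind. Taking norms of
  \<open>t ^ n - \<Prod>j. X j ^ c j\<close> in all variables \<open>X j\<close> gives a sequence that vanishes exactly when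
  \<open>n = (\<Sum>j. c j * Q ^ b j)\<close> for digit positions \<open>b j\<close> of \<open>n\<close>; this settles the case without carries.

  In general, take \<open>Q = q ^ r\<close> with \<open>r\<close> large. By pigeonhole, some long window of residues modulo \<open>r\<close>
  contains none of the exponents; cutting at its end leaves a bounded remainder plus a multiple of a
  power of \<open>q\<close> whose cofactor is a sum without carries.
\<close>

subsection \<open>Functions along orbits in a torus\<close>

lemma torus_ptsD: "x \<in> torus_pts k \<Longrightarrow> length x = k"
  by (simp add: torus_pts_def)

text \<open>Sums and products of Laurent polynomials produce repeated exponent vectors, while the
  definition sums over a set of them; the coefficients of equal vectors are collected here.\<close>

lemma laurent_funI:
  fixes f :: "'k::field list \<Rightarrow> 'k"
  assumes "finite I" and "\<And>i. i \<in> I \<Longrightarrow> length (e i) = k"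
    and "\<And>x. x \<in> torus_pts k \<Longrightarrow> f x = (\<Sum>i\<in>I. b i * laurent_mono (e i) x)"
  shows "laurent_fun k f"
  unfolding laurent_fun_def
proof (intro exI conjI ballI)
  show "finite (e ` I)" using assms(1) by simp
  show "length \<epsilon> = k" if "\<epsilon> \<in> e ` I" for \<epsilon> using that assms(2) by auto
  fix x :: "'k list" assume x: "x \<in> torus_pts k"
  have "f x = (\<Sum>\<epsilon>\<in>e ` I. \<Sum>i\<in>{i\<in>I. e i = \<epsilon>}. b i * laurent_mono (e i) x)"
    unfolding assms(3)[OF x] by (rule sum.image_gen[OF assms(1)])
  also have "\<dots> = (\<Sum>\<epsilon>\<in>e ` I. (\<Sum>i\<in>{i\<in>I. e i = \<epsilon>}. b i) * laurent_mono \<epsilon> x)"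
    by (auto simp: sum_distrib_right intro!: sum.cong)
  finally show "f x = (\<Sum>\<epsilon>\<in>e ` I. (\<Sum>i\<in>{i\<in>I. e i = \<epsilon>}. b i) * laurent_mono \<epsilon> x)" .
qed

lemma laurent_mono_replicate_0 [simp]: "length x = k \<Longrightarrow> laurent_mono (replicate k 0) x = 1"
  by (simp add: laurent_mono_def)

lemma laurent_mono_single:
  assumes "length x = k" "i < k"
  shows "laurent_mono ((replicate k 0)[i := z]) x = (x ! i) powi z"
proof -
  have "laurent_mono ((replicate k 0)[i := z]) x = (\<Prod>j<k. if j = i then (x ! i) powi z else 1)"
    unfolding laurent_mono_def using assms by (intro prod.cong) (auto simp: nth_list_update)
  then show ?thesis using assms by simp
qed

lemma laurent_fun_nth_powi: "i < k \<Longrightarrow> laurent_fun k (\<lambda>x. c * (x ! i) powi z)"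
  by (rule laurent_funI[of "{()}" "\<lambda>_. (replicate k 0)[i := z]" k _ "\<lambda>_. c"])
     (auto dest: torus_ptsD simp: laurent_mono_single)

lemma laurent_fun_nth: "i < k \<Longrightarrow> laurent_fun k (\<lambda>x. x ! i)"
  using laurent_fun_nth_powi[of i k 1 1] by simp

lemma laurent_fun_add:
  fixes f g :: "'a::field list \<Rightarrow> 'a"
  assumes "laurent_fun k f" "laurent_fun k g"
  shows "laurent_fun k (\<lambda>x. f x + g x)"
proof -
  from assms(1) obtain E a where E: "finite E" "\<forall>e\<in>E. length e = k"
      "\<forall>x\<in>torus_pts k. f x = (\<Sum>e\<in>E. a e * laurent_mono e x)"
    unfolding laurent_fun_def by blast
  from assms(2) obtain F b where F: "finite F" "\<forall>e\<in>F. length e = k"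
      "\<forall>x\<in>torus_pts k. g x = (\<Sum>e\<in>F. b e * laurent_mono e x)"
    unfolding laurent_fun_def by blast
  show ?thesis
  proof (rule laurent_funI[of "E <+> F" "case_sum id id" k _ "case_sum a b"])
    fix x :: "'a list" assume "x \<in> torus_pts k"
    then show "f x + g x =
        (\<Sum>i\<in>E <+> F. case_sum a b i * laurent_mono (case_sum id id i) x)"
      using E F by (simp add: sum.Plus)
  qed (use E F in auto)
qed

lemma laurent_mono_mult:
  assumes "x \<in> torus_pts k" "length e = k" "length e' = k"
  shows "laurent_mono (map2 (+) e e') x = laurent_mono e x * laurent_mono e' x"
  unfolding laurent_mono_def prod.distrib [symmetric]
  using assms by (intro prod.cong) (auto simp: power_int_add torus_pts_def)

lemma laurent_fun_mult:
  fixes f g :: "'a::field list \<Rightarrow> 'a"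
  assumes "laurent_fun k f" "laurent_fun k g"
  shows "laurent_fun k (\<lambda>x. f x * g x)"
proof -
  from assms(1) obtain E a where E: "finite E" "\<forall>e\<in>E. length e = k"
      "\<forall>x\<in>torus_pts k. f x = (\<Sum>e\<in>E. a e * laurent_mono e x)"
    unfolding laurent_fun_def by blast
  from assms(2) obtain F b where F: "finite F" "\<forall>e\<in>F. length e = k"
      "\<forall>x\<in>torus_pts k. g x = (\<Sum>e\<in>F. b e * laurent_mono e x)"
    unfolding laurent_fun_def by blast
  show ?thesis
  proof (rule laurent_funI[of "E \<times> F" "\<lambda>(e, e'). map2 (+) e e'" k _ "\<lambda>(e, e'). a e * b e'"])
    fix x :: "'a list" assume x: "x \<in> torus_pts k"
    have "f x * g x = (\<Sum>(e, e')\<in>E \<times> F. (a e * laurent_mono e x) * (b e' * laurent_mono e' x))"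
      using E F x by (simp add: sum_product sum.cartesian_product)
    also have "\<dots> = (\<Sum>i\<in>E \<times> F. (case i of (e, e') \<Rightarrow> a e * b e') *
        laurent_mono (case i of (e, e') \<Rightarrow> map2 (+) e e') x)"
      using E F x by (intro sum.cong) (auto simp: laurent_mono_mult)
    finally show "f x * g x = \<dots>" .
  qed (use E F in auto)
qed

lemma take_torus_pts: "x \<in> torus_pts (k + l) \<Longrightarrow> take k x \<in> torus_pts k"
  and drop_torus_pts: "x \<in> torus_pts (k + l) \<Longrightarrow> drop k x \<in> torus_pts l"
  by (auto simp: torus_pts_def)

lemma append_torus_pts: "x \<in> torus_pts k \<Longrightarrow> y \<in> torus_pts l \<Longrightarrow> x @ y \<in> torus_pts (k + l)"
  by (auto simp: torus_pts_def nth_append)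

lemma prod_lessThan_add:
  fixes f :: "nat \<Rightarrow> 'a::comm_monoid_mult"
  shows "(\<Prod>i<a + b. f i) = (\<Prod>i<a. f i) * (\<Prod>i<b. f (a + i))"
  by (induction b) (simp_all add: mult.assoc)

lemma laurent_mono_append:
  assumes "length e = length x"
  shows "laurent_mono (e @ e') (x @ y) = laurent_mono e x * laurent_mono e' y"
  using assms by (simp add: laurent_mono_def prod_lessThan_add nth_append)

lemma laurent_fun_take:
  fixes f :: "'a::field list \<Rightarrow> 'a"
  assumes "laurent_fun k f"
  shows "laurent_fun (k + l) (\<lambda>x. f (take k x))"
proof -
  from assms obtain E a where E: "finite E" "\<forall>e\<in>E. length e = k"
      "\<forall>x\<in>torus_pts k. f x = (\<Sum>e\<in>E. a e * laurent_mono e x)"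
    unfolding laurent_fun_def by blast
  show ?thesis
  proof (rule laurent_funI[of E "\<lambda>e. e @ replicate l 0" _ _ a])
    fix x :: "'a list" assume x: "x \<in> torus_pts (k + l)"
    have "laurent_mono (e @ replicate l 0) x = laurent_mono e (take k x)" if "e \<in> E" for e
      using laurent_mono_append[of e "take k x" "replicate l 0" "drop k x"] that E x
      by (auto dest!: torus_ptsD)
    then show "f (take k x) = (\<Sum>e\<in>E. a e * laurent_mono (e @ replicate l 0) x)"
      using E take_torus_pts[OF x] by auto
  qed (use E in auto)
qed

lemma laurent_fun_drop:
  fixes f :: "'a::field list \<Rightarrow> 'a"
  assumes "laurent_fun l f"
  shows "laurent_fun (k + l) (\<lambda>x. f (drop k x))"
proof -
  from assms obtain E a where E: "finite E" "\<forall>e\<in>E. length e = l"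
      "\<forall>x\<in>torus_pts l. f x = (\<Sum>e\<in>E. a e * laurent_mono e x)"
    unfolding laurent_fun_def by blast
  show ?thesis
  proof (rule laurent_funI[of E "\<lambda>e. replicate k 0 @ e" _ _ a])
    fix x :: "'a list" assume x: "x \<in> torus_pts (k + l)"
    have "laurent_mono (replicate k 0 @ e) x = laurent_mono e (drop k x)" if "e \<in> E" for e
      using laurent_mono_append[of "replicate k 0" "take k x" e "drop k x"] that E x
      by (auto dest!: torus_ptsD)
    then show "f (drop k x) = (\<Sum>e\<in>E. a e * laurent_mono (replicate k 0 @ e) x)"
      using E drop_torus_pts[OF x] by auto
  qed (use E in auto)
qed

lemma torus_endo_closed:
  assumes "torus_endo k \<Phi>" "x \<in> torus_pts k"
  shows "\<Phi> x \<in> torus_pts k"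
proof -
  have "\<Phi> x ! i \<noteq> 0" if "i < k" for i
    using assms that unfolding torus_endo_def by (metis mult_zero_left zero_neq_one)
  then show ?thesis using assms by (auto simp: torus_pts_def torus_endo_def)
qed

lemma torus_endo_funpow_closed:
  "torus_endo k \<Phi> \<Longrightarrow> x \<in> torus_pts k \<Longrightarrow> (\<Phi> ^^ n) x \<in> torus_pts k"
  by (induction n) (auto simp: torus_endo_closed)

section \<open>Product tori and orbit functions\<close>

definition prod_map :: "nat \<Rightarrow> ('k list \<Rightarrow> 'k list) \<Rightarrow> ('k list \<Rightarrow> 'k list) \<Rightarrow> 'k list \<Rightarrow> 'k list" where
  "prod_map k \<Phi> \<Psi> x = \<Phi> (take k x) @ \<Psi> (drop k x)"

lemma torus_endo_prod_map:
  fixes \<Phi> \<Psi> :: "'a::field list \<Rightarrow> 'a list"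
  assumes "torus_endo k \<Phi>" "torus_endo l \<Psi>"
  shows "torus_endo (k + l) (prod_map k \<Phi> \<Psi>)"
  unfolding torus_endo_def
proof (intro conjI ballI allI impI)
  fix x :: "'a list" assume x: "x \<in> torus_pts (k + l)"
  show "length (prod_map k \<Phi> \<Psi> x) = k + l"
    using torus_endo_closed[OF assms(1) take_torus_pts[OF x]]
      torus_endo_closed[OF assms(2) drop_torus_pts[OF x]]
    by (simp add: prod_map_def torus_pts_def)
next
  fix i assume i: "i < k + l"
  have len: "length (\<Phi> (take k x)) = k" if "x \<in> torus_pts (k + l)" for x :: "'a list"
    using torus_endo_closed[OF assms(1) take_torus_pts[OF that]] by (rule torus_ptsD)
  show "\<exists>f g. laurent_fun (k + l) f \<and> laurent_fun (k + l) g \<and>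
          (\<forall>x\<in>torus_pts (k + l). prod_map k \<Phi> \<Psi> x ! i = f x \<and> f x * g x = 1)"
  proof (cases "i < k")
    case True
    with assms(1) obtain f g where fg: "laurent_fun k f" "laurent_fun k g"
        "\<forall>x\<in>torus_pts k. \<Phi> x ! i = f x \<and> f x * g x = 1"
      unfolding torus_endo_def by blast
    then show ?thesis
      by (intro exI[of _ "\<lambda>x. f (take k x)"] exI[of _ "\<lambda>x. g (take k x)"])
         (use True len in \<open>auto simp: laurent_fun_take take_torus_pts prod_map_def nth_append\<close>)
  next
    case False
    with i have "i - k < l" by simp
    with assms(2) obtain f g where fg: "laurent_fun l f" "laurent_fun l g"
        "\<forall>x\<in>torus_pts l. \<Psi> x ! (i - k) = f x \<and> f x * g x = 1"
      unfolding torus_endo_def by blast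
    then show ?thesis
      by (intro exI[of _ "\<lambda>x. f (drop k x)"] exI[of _ "\<lambda>x. g (drop k x)"])
         (use False len in \<open>auto simp: laurent_fun_drop drop_torus_pts prod_map_def nth_append\<close>)
  qed
qed

lemma funpow_prod_map:
  assumes "torus_endo k \<Phi>" "x \<in> torus_pts k"
  shows "(prod_map k \<Phi> \<Psi> ^^ n) (x @ y) = (\<Phi> ^^ n) x @ (\<Psi> ^^ n) y"
proof (induction n)
  case (Suc n)
  have "length ((\<Phi> ^^ n) x) = k"
    using torus_endo_funpow_closed[OF assms] by (rule torus_ptsD)
  with Suc show ?case by (simp add: prod_map_def)
qed simp

definition torus_orbit_fun :: "(nat \<Rightarrow> 'k::field) \<Rightarrow> bool" where
  "torus_orbit_fun f \<longleftrightarrow> (\<exists>k \<Phi> \<alpha> L. k \<ge> 1 \<and> torus_endo k \<Phi> \<and> \<alpha> \<in> torus_pts k \<and>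
     laurent_fun k L \<and> (\<forall>n. f n = L ((\<Phi> ^^ n) \<alpha>)))"

text \<open>The two orbits run side by side in the product torus, and \<open>h\<close> combines the
  pullbacks of the two regular functions along the projections.\<close>

lemma torus_orbit_fun_combine:
  fixes f g :: "nat \<Rightarrow> 'k::field"
  assumes "torus_orbit_fun f" "torus_orbit_fun g"
    and h: "\<And>k F G. laurent_fun k F \<Longrightarrow> laurent_fun k G \<Longrightarrow>
      laurent_fun k (\<lambda>x. h (F x) (G x) :: 'k)"
  shows "torus_orbit_fun (\<lambda>n. h (f n) (g n))"
proof -
  from assms(1) obtain k \<Phi> \<alpha> F where f: "k \<ge> 1" "torus_endo k \<Phi>" "\<alpha> \<in> torus_pts k"
      "laurent_fun k F" "\<And>n. f n = F ((\<Phi> ^^ n) \<alpha>)"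
    unfolding torus_orbit_fun_def by blast
  from assms(2) obtain l \<Psi> \<beta> G where g: "l \<ge> 1" "torus_endo l \<Psi>" "\<beta> \<in> torus_pts l"
      "laurent_fun l G" "\<And>n. g n = G ((\<Psi> ^^ n) \<beta>)"
    unfolding torus_orbit_fun_def by blast
  have len: "length ((\<Phi> ^^ n) \<alpha>) = k" for n
    using torus_endo_funpow_closed[OF f(2,3)] by (rule torus_ptsD)
  show ?thesis unfolding torus_orbit_fun_def
  proof (intro exI conjI allI)
    show "k + l \<ge> 1" using f by simp
    show "torus_endo (k + l) (prod_map k \<Phi> \<Psi>)" using f g by (intro torus_endo_prod_map)
    show "\<alpha> @ \<beta> \<in> torus_pts (k + l)" using f g by (intro append_torus_pts)
    show "laurent_fun (k + l) (\<lambda>x. h (F (take k x)) (G (drop k x)))"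
      using f g by (intro h laurent_fun_take laurent_fun_drop)
    show "h (f n) (g n) = h (F (take k ((prod_map k \<Phi> \<Psi> ^^ n) (\<alpha> @ \<beta>))))
        (G (drop k ((prod_map k \<Phi> \<Psi> ^^ n) (\<alpha> @ \<beta>))))" for n
      using f g len by (simp add: funpow_prod_map)
  qed
qed

text \<open>The endomorphism is the translation of the one-dimensional torus by \<open>g\<close>,
  started at \<open>1\<close>.\<close>

lemma torus_orbit_fun_power:
  fixes g :: "'k::field"
  assumes "g \<noteq> 0"
  shows "torus_orbit_fun (\<lambda>n. g ^ n)"
  unfolding torus_orbit_fun_def
proof (intro exI conjI allI)
  have L: "laurent_fun 1 (\<lambda>x. g * x ! 0)" "laurent_fun 1 (\<lambda>x. inverse g * (x ! 0) powi (-1))"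
    using laurent_fun_nth_powi[of 0 1 g 1] laurent_fun_nth_powi[of 0 1 "inverse g" "-1"] by simp_all
  have "[g * x ! 0] ! 0 = g * x ! 0 \<and> g * x ! 0 * (inverse g * (x ! 0) powi (-1)) = 1"
    if "x \<in> torus_pts 1" for x
    using that assms by (simp add: torus_pts_def power_int_minus field_simps)
  with L show "torus_endo 1 (\<lambda>x. [g * x ! 0])"
    unfolding torus_endo_def by (simp only: less_one) (auto simp: torus_pts_def)
  show "[1] \<in> torus_pts 1" by (simp add: torus_pts_def)
  show "laurent_fun 1 (\<lambda>x. x ! 0)" by (rule laurent_fun_nth) simp
  have "((\<lambda>x. [g * x ! 0]) ^^ n) [1] = [g ^ n]" for n by (induction n) auto
  then show "g ^ n = ((\<lambda>x. [g * x ! 0]) ^^ n) [1] ! 0" for n by simp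
qed simp

text \<open>The endomorphism permutes the coordinates cyclically, started at the list of values over
  one period. Since no value is zero, this list is a point of the torus.\<close>

lemma torus_orbit_fun_periodic:
  fixes \<chi> :: "nat \<Rightarrow> 'k::field"
  assumes "N \<ge> 1" "\<And>n. \<chi> (n mod N) = \<chi> n" "\<And>n. \<chi> n \<noteq> 0"
  shows "torus_orbit_fun \<chi>"
  unfolding torus_orbit_fun_def
proof (intro exI conjI allI)
  show "N \<ge> 1" by fact
  show "torus_endo N (rotate1 :: 'k list \<Rightarrow> _)" unfolding torus_endo_def
  proof (intro conjI ballI allI impI)
    fix i assume i: "i < N"
    let ?j = "Suc i mod N"
    have j: "?j < N" using assms(1) by simp
    have "rotate1 x ! i = x ! ?j \<and> x ! ?j * (1 * (x ! ?j) powi (-1)) = 1"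
      if x: "x \<in> torus_pts N" for x :: "'k list"
    proof -
      have "length x = N" "x ! ?j \<noteq> 0" using x j unfolding torus_pts_def by blast+
      with i show ?thesis by (simp only: nth_rotate1 power_int_minus) simp
    qed
    then have "\<forall>x\<in>torus_pts N. rotate1 (x::'k list) ! i = x ! ?j \<and>
        x ! ?j * (1 * (x ! ?j) powi (-1)) = 1"
      by blast
    then have "laurent_fun N (\<lambda>x::'k list. x ! ?j) \<and>
        laurent_fun N (\<lambda>x::'k list. 1 * (x ! ?j) powi (-1)) \<and>
        (\<forall>x\<in>torus_pts N. rotate1 (x::'k list) ! i = x ! ?j \<and> x ! ?j * (1 * (x ! ?j) powi (-1)) = 1)"
      using laurent_fun_nth[OF j] laurent_fun_nth_powi[OF j] by blast
    then show "\<exists>f g. laurent_fun N f \<and> laurent_fun N g \<and>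
        (\<forall>x\<in>torus_pts N. rotate1 (x::'k list) ! i = f x \<and> f x * g x = 1)"
      by - (rule exI[of _ "\<lambda>x. x ! ?j"], rule exI[of _ "\<lambda>x. 1 * (x ! ?j) powi (-1)"])
  qed (simp add: torus_pts_def)
  show "map \<chi> [0..<N] \<in> torus_pts N" using assms by (simp add: torus_pts_def)
  show "laurent_fun N (\<lambda>x. x ! 0)" using assms(1) by (intro laurent_fun_nth) simp
  show "\<chi> n = (rotate1 ^^ n) (map \<chi> [0..<N]) ! 0" for n
    using assms by (simp add: nth_rotate flip: rotate_def)
qed

text \<open>The generators are orbit functions of cyclic permutations and of translations.
  Generating the class inductively lets stability under operations such as \<open>n div D\<close> be
  proved by induction.\<close>

inductive_set exp_seq :: "(nat \<Rightarrow> 'k::field) set" where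
  periodic: "N \<ge> 1 \<Longrightarrow> (\<And>n. \<chi> (n mod N) = \<chi> n) \<Longrightarrow> (\<And>n. \<chi> n \<noteq> 0) \<Longrightarrow> \<chi> \<in> exp_seq"
| power: "g \<noteq> 0 \<Longrightarrow> (\<lambda>n. g ^ n) \<in> exp_seq"
| add: "f \<in> exp_seq \<Longrightarrow> g \<in> exp_seq \<Longrightarrow> (\<lambda>n. f n + g n) \<in> exp_seq"
| mult: "f \<in> exp_seq \<Longrightarrow> g \<in> exp_seq \<Longrightarrow> (\<lambda>n. f n * g n) \<in> exp_seq"

lemma torus_orbit_fun_exp_seq: "f \<in> exp_seq \<Longrightarrow> torus_orbit_fun f"
  by (induction rule: exp_seq.induct)
     (auto intro: torus_orbit_fun_periodic torus_orbit_fun_power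
        torus_orbit_fun_combine laurent_fun_add laurent_fun_mult)

lemma dml_split_torus_exp_seq:
  fixes f :: "nat \<Rightarrow> 'k::field"
  assumes "f \<in> exp_seq"
  shows "dml_split_torus TYPE('k) {n. f n = 0}"
proof -
  obtain k \<Phi> \<alpha> L where f: "k \<ge> 1" "torus_endo k \<Phi>" "\<alpha> \<in> torus_pts k"
      "laurent_fun k L" "\<And>n. f n = L ((\<Phi> ^^ n) \<alpha>)"
    using torus_orbit_fun_exp_seq[OF assms] unfolding torus_orbit_fun_def by blast
  have "torus_closed k {x \<in> torus_pts k. \<forall>f\<in>{L}. f x = 0}"
    unfolding torus_closed_def using f by (intro exI[of _ "{L}"]) auto
  moreover have "{n. f n = 0} = {n. (\<Phi> ^^ n) \<alpha> \<in> {x \<in> torus_pts k. \<forall>f\<in>{L}. f x = 0}}"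
    using f torus_endo_funpow_closed[OF f(2,3)] by simp
  ultimately have "dml_torus TYPE('k) k {n. f n = 0}"
    unfolding dml_torus_def using f(2,3) by blast
  with f(1) show ?thesis
    unfolding dml_split_torus_def by blast
qed

subsection \<open>Zero sets of exponential sequences\<close>

lemma exp_seq_nonzero_const: "c \<noteq> 0 \<Longrightarrow> (\<lambda>n. c) \<in> exp_seq"
  by (rule exp_seq.periodic[of 1]) auto

text \<open>A periodic generator must not vanish, so the constant zero arises as
  \<open>1 + (-1)\<close>.\<close>

lemma exp_seq_const: "(\<lambda>n. c) \<in> exp_seq"
  using exp_seq.add[OF exp_seq_nonzero_const[of 1] exp_seq_nonzero_const[of "-1"]]
    exp_seq_nonzero_const[of c] by (cases "c = 0") auto

lemma exp_seq_diff:
  assumes "f \<in> exp_seq" "g \<in> exp_seq"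
  shows "(\<lambda>n. f n - g n) \<in> exp_seq"
  using exp_seq.add[OF assms(1) exp_seq.mult[OF exp_seq_const[of "-1"] assms(2)]] by simp

lemma exp_seq_sum: "(\<And>i. i \<in> I \<Longrightarrow> f i \<in> exp_seq) \<Longrightarrow> (\<lambda>n. \<Sum>i\<in>I. f i n) \<in> exp_seq"
  by (induction I rule: infinite_finite_induct) (auto intro: exp_seq_const exp_seq.add)

lemma exp_seq_pow: "f \<in> exp_seq \<Longrightarrow> (\<lambda>n. f n ^ i) \<in> exp_seq"
  by (induction i) (auto intro: exp_seq_const exp_seq.mult)

text \<open>The outer exponent \<open>D\<close> spares a \<open>D\<close>-th root of
  \<open>g\<close>: \<open>(g ^ (n div D)) ^ D\<close> is \<open>g ^ n\<close> times a factor
  depending only on \<open>n mod D\<close>. As \<open>D\<close> is a power of the characteristic,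
  the \<open>D\<close>-th power map is additive and sums pass through; zeros are unaffected by
  it.\<close>

lemma exp_seq_div:
  fixes f :: "nat \<Rightarrow> 'k::field"
  assumes "prime CHAR('k)" and D: "D = CHAR('k) ^ e" and "f \<in> exp_seq"
  shows "(\<lambda>n. f (n div D) ^ D) \<in> exp_seq"
  using assms(3)
proof (induction rule: exp_seq.induct)
  case (periodic N \<chi>)
  have "D \<ge> 1" using assms(1) by (simp add: D Suc_le_eq prime_gt_0_nat)
  have "\<chi> (n mod (N * D) div D) = \<chi> (n div D)" for n
    using periodic(2)[of "n div D"] \<open>D \<ge> 1\<close> by (simp add: mult.commute[of N] mod_mult2_eq)
  then show ?case
    using periodic \<open>D \<ge> 1\<close> by (intro exp_seq.periodic[of "N * D"]) auto
next
  case (power g)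
  have "D \<ge> 1" using assms(1) by (simp add: D Suc_le_eq prime_gt_0_nat)
  have "(g ^ (n div D)) ^ D = g ^ n * inverse g ^ (n mod D)" for n
  proof -
    have "g ^ n = (g ^ (n div D)) ^ D * g ^ (n mod D)"
      by (simp flip: power_add power_mult)
    then show ?thesis
      using power by (simp add: field_simps)
  qed
  moreover have "(\<lambda>n. inverse g ^ (n mod D)) \<in> exp_seq"
    using power \<open>D \<ge> 1\<close> by (intro exp_seq.periodic[of D]) auto
  ultimately show ?case
    using exp_seq.mult[OF exp_seq.power[OF power]] by simp
next
  case (add f g)
  then show ?case
    unfolding freshmans_dream'[OF assms(1,2)] by (intro exp_seq.add)
next
  case (mult f g)
  then show ?case by (auto simp: power_mult_distrib intro: exp_seq.mult)
qed

definition exp_zero :: "'k::field itself \<Rightarrow> nat set \<Rightarrow> bool" where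
  "exp_zero _ S \<longleftrightarrow> (\<exists>f::nat \<Rightarrow> 'k. f \<in> exp_seq \<and> S = {n. f n = 0})"

lemma exp_zeroI: "f \<in> exp_seq \<Longrightarrow> S = {n. (f n :: 'k::field) = 0} \<Longrightarrow> exp_zero TYPE('k) S"
  unfolding exp_zero_def by blast

lemma exp_zero_eq:
  fixes f g :: "nat \<Rightarrow> 'k::field"
  assumes "f \<in> exp_seq" "g \<in> exp_seq"
  shows "exp_zero TYPE('k) {n. f n = g n}"
  by (rule exp_zeroI[OF exp_seq_diff[OF assms]]) auto

lemma exp_zero_Un:
  assumes "exp_zero TYPE('k::field) S" "exp_zero TYPE('k) S'"
  shows "exp_zero TYPE('k) (S \<union> S')"
proof -
  obtain f :: "nat \<Rightarrow> 'k" where f: "f \<in> exp_seq" "S = {n. f n = 0}"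
    using assms(1) unfolding exp_zero_def by blast
  obtain g :: "nat \<Rightarrow> 'k" where g: "g \<in> exp_seq" "S' = {n. g n = 0}"
    using assms(2) unfolding exp_zero_def by blast
  show ?thesis
    by (rule exp_zeroI[OF exp_seq.mult[OF f(1) g(1)]]) (auto simp: f g)
qed

lemma exp_zero_empty: "exp_zero TYPE('k::field) {}"
  by (rule exp_zeroI[OF exp_seq_const[of 1]]) auto

lemma exp_zero_Union:
  assumes "finite \<S>" "\<And>S. S \<in> \<S> \<Longrightarrow> exp_zero TYPE('k::field) S"
  shows "exp_zero TYPE('k) (\<Union>\<S>)"
  using assms by (induction \<S> rule: finite_induct) (auto intro: exp_zero_Un exp_zero_empty)

lemma exp_zero_div:
  assumes "prime CHAR('k::field)" "D = CHAR('k) ^ e" "exp_zero TYPE('k) S"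
  shows "exp_zero TYPE('k) {n. n div D \<in> S}"
proof -
  obtain f :: "nat \<Rightarrow> 'k" where f: "f \<in> exp_seq" "S = {n. f n = 0}"
    using assms(3) unfolding exp_zero_def by blast
  have "D > 0" using assms(1,2) by (simp add: prime_gt_0_nat)
  then show ?thesis
    by (intro exp_zeroI[OF exp_seq_div[OF assms(1,2) f(1)]]) (simp add: f)
qed

section \<open>The field of rational functions\<close>

definition indet :: "'a::field poly fract" where
  "indet = to_fract [:0, 1:]"

definition const_fract :: "'a::field \<Rightarrow> 'a poly fract" where
  "const_fract x = to_fract [:x:]"

lemma const_fract_0 [simp]: "const_fract 0 = 0"
  and const_fract_1 [simp]: "const_fract 1 = 1"
  and const_fract_add: "const_fract (x + y) = const_fract x + const_fract y"
  and const_fract_mult: "const_fract (x * y) = const_fract x * const_fract y"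
  by (simp_all add: const_fract_def flip: to_fract_add to_fract_mult one_pCons)

lemma const_fract_power: "const_fract (x ^ n) = const_fract x ^ n"
  by (induction n) (simp_all add: const_fract_mult)

lemma const_fract_sum: "const_fract (\<Sum>i\<in>I. f i) = (\<Sum>i\<in>I. const_fract (f i))"
  by (induction I rule: infinite_finite_induct) (simp_all add: const_fract_add)

lemma const_fract_of_nat: "const_fract (of_nat n) = of_nat n"
  by (induction n) (simp_all add: const_fract_add)

lemma const_fract_eq_0_iff [simp]: "const_fract x = 0 \<longleftrightarrow> x = 0"
  by (simp add: const_fract_def)

lemma to_fract_power: "to_fract (x ^ n) = to_fract x ^ n"
  by (induction n) simp_all

lemma indet_power: "indet ^ n = to_fract (monom 1 n)"
  by (simp add: indet_def monom_altdef flip: to_fract_power)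

lemma indet_nonzero [simp]: "indet \<noteq> 0"
  by (simp add: indet_def)

lemma indet_power_eq_iff [simp]: "indet ^ m = indet ^ n \<longleftrightarrow> m = n"
  unfolding indet_power to_fract_eq_iff by (metis degree_monom_eq zero_neq_one)

lemma const_fract_indet_power: "const_fract c * indet ^ n = to_fract (monom c n)"
  by (simp add: indet_power const_fract_def smult_monom flip: to_fract_mult)

lemma CHAR_fract_poly: "CHAR('a::field poly fract) = CHAR('a)"
  by (rule CHAR_eqI)
     (auto simp: of_nat_eq_0_iff_char_dvd simp flip: const_fract_of_nat)

text \<open>With denominators cleared, a nonzero left side has even degree and a nonzero right side
  has odd degree.\<close>

lemma square_eq_indet_mult_square:
  fixes a b :: "'a::field poly fract"
  assumes "a\<^sup>2 = indet * b\<^sup>2"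
  shows "a = 0 \<and> b = 0"
proof -
  obtain a1 a2 where a: "a = to_fract a1 / to_fract a2" "a2 \<noteq> 0"
    by (cases a) (simp add: Fract_conv_to_fract)
  obtain b1 b2 where b: "b = to_fract b1 / to_fract b2" "b2 \<noteq> 0"
    by (cases b) (simp add: Fract_conv_to_fract)
  obtain X :: "'a poly" where X: "X = [:0, 1:]" by blast
  have "to_fract ((a1 * b2)\<^sup>2) = to_fract (X * (b1 * a2)\<^sup>2)"
    using assms a b by (simp add: indet_def field_simps power2_eq_square flip: X)
  then have eq: "(a1 * b2)\<^sup>2 = [:0, 1:] * (b1 * a2)\<^sup>2"
    by (simp only: to_fract_eq_iff X)
  show ?thesis
  proof (cases "b1 = 0")
    case True
    with eq a b show ?thesis by simp
  next
    case False
    then have nz: "b1 * a2 \<noteq> 0" using a by simp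
    then have "degree ([:0, 1:] * (b1 * a2)\<^sup>2) = 1 + 2 * degree (b1 * a2)"
      by (subst degree_mult_eq) (simp_all add: degree_power_eq del: mult_pCons_left)
    moreover have "degree ((a1 * b2)\<^sup>2) = 2 * degree (a1 * b2)"
    proof -
      have "a1 * b2 \<noteq> 0" using eq nz by auto
      then show ?thesis by (simp add: degree_power_eq)
    qed
    ultimately have "2 * degree (a1 * b2) = 1 + 2 * degree (b1 * a2)"
      using eq by simp
    then show ?thesis by presburger
  qed
qed

text \<open>Two equations are merged into one because the indeterminate is not a square.\<close>
lemma exp_zero_Int:
  fixes K :: "'a::field poly fract itself"
  assumes "exp_zero K S" "exp_zero K S'"
  shows "exp_zero K (S \<inter> S')"
proof -
  obtain f :: "nat \<Rightarrow> 'a poly fract" where f: "f \<in> exp_seq" "S = {n. f n = 0}"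
    using assms(1) unfolding exp_zero_def by blast
  obtain g :: "nat \<Rightarrow> 'a poly fract" where g: "g \<in> exp_seq" "S' = {n. g n = 0}"
    using assms(2) unfolding exp_zero_def by blast
  have "(f n)\<^sup>2 = indet * (g n)\<^sup>2 \<longleftrightarrow> f n = 0 \<and> g n = 0" for n
    using square_eq_indet_mult_square[of "f n" "g n"] by auto
  then have "S \<inter> S' = {n. (f n)\<^sup>2 = indet * (g n)\<^sup>2}"
    using f g by auto
  moreover have "exp_zero TYPE('a poly fract) {n. (f n)\<^sup>2 = indet * (g n)\<^sup>2}"
    using f g by (intro exp_zero_eq exp_seq_pow exp_seq.mult exp_seq_const)
  ultimately show ?thesis by (simp add: exp_zero_def)
qed

lemma exp_zero_UNIV: "exp_zero TYPE('k::field) UNIV"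
  by (rule exp_zeroI[OF exp_seq_const[of 0]]) auto

lemma exp_zero_Ball:
  fixes K :: "'a::field poly fract itself"
  assumes "finite I" "\<And>i. i \<in> I \<Longrightarrow> exp_zero K {n. P i n}"
  shows "exp_zero K {n. \<forall>i\<in>I. P i n}"
  using assms
proof (induction I rule: finite_induct)
  case empty
  show ?case using exp_zero_UNIV[where 'k = "'a poly fract"] by (simp add: exp_zero_def)
next
  case (insert i I)
  then have "exp_zero K ({n. P i n} \<inter> {n. \<forall>i\<in>I. P i n})" by (intro exp_zero_Int) auto
  then show ?case by (simp add: Collect_conj_eq)
qed

lemma exp_zero_mod:
  assumes "D \<ge> 1"
  shows "exp_zero TYPE('a::field poly fract) {n. n mod D = r}"
proof -
  \<comment> \<open>The values \<open>1\<close> and \<open>indet\<close> are distinct, and both are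
    nonzero as a periodic generator requires.\<close>
  define \<chi> :: "nat \<Rightarrow> 'a poly fract" where "\<chi> n = (if n mod D = r then 1 else indet)" for n
  have "\<chi> \<in> exp_seq"
    using assms by (intro exp_seq.periodic[of D]) (auto simp: \<chi>_def)
  then have "exp_zero TYPE('a poly fract) {n. \<chi> n = 1}"
    by (intro exp_zero_eq exp_seq_const)
  moreover have "indet \<noteq> (1 :: 'a poly fract)"
    using indet_power_eq_iff[of 1 0] by simp
  then have "\<chi> n = 1 \<longleftrightarrow> n mod D = r" for n by (simp add: \<chi>_def)
  ultimately show ?thesis by simp
qed

lemma exp_zero_singleton: "exp_zero TYPE('a::field poly fract) {r}"
proof -
  have "exp_zero TYPE('a poly fract) {n. indet ^ n = (indet ^ r :: 'a poly fract)}"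
    by (rule exp_zero_eq[OF exp_seq.power exp_seq_const]) simp
  then show ?thesis by simp
qed

text \<open>The polynomial \<open>f\<close> splits into \<open>Q\<close> linear factors, which are
  distinct because its derivative is the constant \<open>-1\<close>. For \<open>Q\<close> a positive
  power of a prime characteristic, the roots form the field with \<open>Q\<close> elements.\<close>

lemma card_roots_power_eq_self:
  fixes Q :: nat
  assumes "of_nat Q = (0 :: 'a::alg_closed_field)" "Q \<ge> 2"
  shows "card {x::'a. x ^ Q = x} = Q"
proof -
  define f :: "'a poly" where "f = monom 1 Q + [:0, -1:]"
  have deg: "degree f = Q"
    unfolding f_def using assms(2) by (subst degree_add_eq_left) (auto simp: degree_monom_eq)
  have f0: "f \<noteq> 0" using deg assms(2) by auto
  obtain A where A: "size A = degree f" "f = smult (lead_coeff f) (\<Prod>x\<in>#A. [:-x, 1:])"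
    using alg_closed_imp_factorization[OF f0] by blast
  have root: "poly f x = 0 \<longleftrightarrow> x ^ Q = x" for x
    by (simp add: f_def poly_monom)
  have "pderiv f = [:-1:]"
    using assms(1) by (simp add: f_def pderiv_add pderiv_monom pderiv_pCons)
  have count: "count A x \<le> 1" for x
  proof (rule ccontr)
    assume "\<not> ?thesis"
    then have "{#x, x#} \<subseteq># A" by (simp add: subseteq_mset_def)
    then obtain B where "A = {#x, x#} + B" by (rule mset_subset_eq_exists_conv[THEN iffD1, THEN exE])
    then have "(\<Prod>x\<in>#A. [:-x, 1:]) = [:-x, 1:] * ([:-x, 1:] * (\<Prod>x\<in>#B. [:-x, 1:]))"
      by (simp del: mult_pCons_left)
    from A(2)[unfolded this] have "f = [:-x, 1:] * ([:-x, 1:] * smult (lead_coeff f) (\<Prod>x\<in>#B. [:-x, 1:]))"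
      by (simp only: mult_smult_right)
    then obtain g where "f = [:-x, 1:] * ([:-x, 1:] * g)" by blast
    then have "poly (pderiv f) x = 0"
      by (simp add: pderiv_mult power2_eq_square del: mult_pCons_left)
    then show False using \<open>pderiv f = [:-1:]\<close> by simp
  qed
  have "poly f x = 0 \<longleftrightarrow> x \<in># A" for x
  proof -
    have "lead_coeff f \<noteq> 0" using f0 by simp
    then have "poly f x = 0 \<longleftrightarrow> poly (\<Prod>x\<in>#A. [:-x, 1:]) x = 0"
      by (subst A(2)) simp
    also have "\<dots> \<longleftrightarrow> x \<in># A"
      by (auto simp: poly_prod_mset prod_mset_zero_iff)
    finally show ?thesis .
  qed
  then have "{x. x ^ Q = x} = set_mset A" using root by auto
  moreover have "size A = card (set_mset A)"
  proof -
    have "size A = (\<Sum>x\<in>set_mset A. count A x)" by (simp add: size_multiset_overloaded_eq)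
    also have "\<dots> = (\<Sum>x\<in>set_mset A. 1)"
    proof (intro sum.cong refl)
      fix x assume "x \<in># A"
      then have "count A x > 0" by simp
      with count[of x] show "count A x = 1" by linarith
    qed
    finally show ?thesis by simp
  qed
  ultimately show ?thesis using A(1) deg by simp
qed

text \<open>The weights are the coefficients of the Lagrange basis polynomials of \<open>L\<close>.\<close>
lemma interpolation_weights:
  fixes L :: "'a::field set"
  assumes "finite L"
  shows "\<exists>\<alpha>. \<forall>w<card L. \<forall>r. (\<Sum>x\<in>L. x ^ w * \<alpha> x r) = (if w = r then 1 else 0)"
proof -
  define h where "h x = smult (inverse (\<Prod>y\<in>L - {x}. x - y)) (\<Prod>y\<in>L - {x}. [:-y, 1:])" for x
  have deg: "degree (h x) < card L" if "x \<in> L" for x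
  proof -
    have "degree (h x) \<le> degree (\<Prod>y\<in>L - {x}. [:-y, 1:])"
      unfolding h_def by (rule degree_smult_le)
    also have "\<dots> \<le> (\<Sum>y\<in>L - {x}. degree [:-y, 1:])"
      using degree_prod_sum_le[of "L - {x}" "\<lambda>y. [:-y, 1:]"] assms by (simp add: o_def)
    also have "\<dots> = card (L - {x})"
      by simp
    also have "\<dots> < card L"
      using that assms by (rule card_Diff1_less[rotated])
    finally show ?thesis .
  qed
  have ell: "poly (h x) y = (if x = y then 1 else 0)" if "x \<in> L" "y \<in> L" for x y
    using that assms by (auto simp: h_def poly_prod)
  have "(\<Sum>x\<in>L. smult (x ^ w) (h x)) = monom 1 w" if w: "w < card L" for w
  proof (rule poly_eqI_degree[where A = L])
    fix y assume y: "y \<in> L"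
    have "poly (\<Sum>x\<in>L. smult (x ^ w) (h x)) y = (\<Sum>x\<in>L. if x = y then y ^ w else 0)"
      unfolding poly_sum by (intro sum.cong) (auto simp: ell[OF _ y])
    then show "poly (\<Sum>x\<in>L. smult (x ^ w) (h x)) y = poly (monom 1 w) y"
      using y assms by (simp add: poly_monom)
  next
    have "degree (\<Sum>x\<in>L. smult (x ^ w) (h x)) \<le> card L - 1"
      using deg assms by (intro degree_sum_le order.trans[OF degree_smult_le]) force+
    then show "degree (\<Sum>x\<in>L. smult (x ^ w) (h x)) < card L" using w by linarith
    show "degree (monom (1::'a) w) < card L" using w by (simp add: degree_monom_eq)
  qed
  then have "coeff (\<Sum>x\<in>L. smult (x ^ w) (h x)) r = coeff (monom 1 w) r" if "w < card L" for w r
    using that by simp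
  then have "(\<Sum>x\<in>L. x ^ w * coeff (h x) r) = (if w = r then 1 else 0)" if "w < card L" for w r
    using that by (simp add: coeff_sum)
  then show ?thesis by (intro exI[of _ "\<lambda>x. coeff (h x)"]) blast
qed

subsection \<open>Norms over the digits\<close>

text \<open>Polynomials in the variables \<open>X j\<close> over the ring of exponential sequences,
  kept as functions so that substitution for one variable is a function update.\<close>

inductive_set exp_poly :: "(nat \<Rightarrow> (nat \<Rightarrow> 'k::field) \<Rightarrow> 'k) set" where
  coeff: "f \<in> exp_seq \<Longrightarrow> (\<lambda>n X. f n) \<in> exp_poly"
| var: "(\<lambda>n X. X j) \<in> exp_poly"
| add: "F \<in> exp_poly \<Longrightarrow> G \<in> exp_poly \<Longrightarrow> (\<lambda>n X. F n X + G n X) \<in> exp_poly"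
| mult: "F \<in> exp_poly \<Longrightarrow> G \<in> exp_poly \<Longrightarrow> (\<lambda>n X. F n X * G n X) \<in> exp_poly"

lemma exp_poly_const: "(\<lambda>n X. c) \<in> exp_poly"
  using exp_poly.coeff[OF exp_seq_const] .

lemma exp_poly_sum:
  "(\<And>i. i \<in> I \<Longrightarrow> F i \<in> exp_poly) \<Longrightarrow> (\<lambda>n X. \<Sum>i\<in>I. F i n X) \<in> exp_poly"
  by (induction I rule: infinite_finite_induct) (auto intro: exp_poly_const exp_poly.add)

lemma exp_poly_prod:
  "(\<And>i. i \<in> I \<Longrightarrow> F i \<in> exp_poly) \<Longrightarrow> (\<lambda>n X. \<Prod>i\<in>I. F i n X) \<in> exp_poly"
  by (induction I rule: infinite_finite_induct) (auto intro: exp_poly_const exp_poly.mult)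

lemma exp_poly_power: "F \<in> exp_poly \<Longrightarrow> (\<lambda>n X. F n X ^ i) \<in> exp_poly"
  by (induction i) (auto intro: exp_poly_const exp_poly.mult)

lemma exp_poly_diff:
  assumes "F \<in> exp_poly" "G \<in> exp_poly"
  shows "(\<lambda>n X. F n X - G n X) \<in> exp_poly"
  using exp_poly.add[OF assms(1) exp_poly.mult[OF exp_poly_const[of "-1"] assms(2)]] by simp

lemma exp_poly_eval: "F \<in> exp_poly \<Longrightarrow> (\<lambda>n. F n X) \<in> exp_seq"
  by (induction rule: exp_poly.induct) (auto intro: exp_seq.intros exp_seq_const)

text \<open>The bound \<open>D\<close> is uniform in \<open>n\<close> and \<open>X\<close>, so
  expansion in one variable leaves a fixed finite number of coefficients, which the norm
  construction can treat one after the other.\<close>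

lemma exp_poly_as_poly:
  assumes "F \<in> exp_poly"
  shows "\<exists>P D. (\<forall>n X z. F n (X(j := z)) = poly (P n X) z) \<and>
    (\<forall>i. (\<lambda>n X. coeff (P n X) i) \<in> exp_poly) \<and> (\<forall>n X. degree (P n X) < D)"
  using assms
proof (induction rule: exp_poly.induct)
  case (coeff f)
  have "(\<lambda>n X. poly.coeff [:f n:] i) \<in> exp_poly" for i
    by (cases i) (auto intro: exp_poly.coeff[OF coeff] exp_poly_const)
  then show ?case
    by (intro exI[of _ "\<lambda>n X. [:f n:]"] exI[of _ 1] conjI allI) auto
next
  case (var i)
  show ?case
  proof (cases "i = j")
    case True
    then show ?thesis
      by (intro exI[of _ "\<lambda>n X. [:0, 1:]"] exI[of _ 2] conjI allI)
         (auto intro!: exp_poly_const)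
  next
    case False
    have "(\<lambda>n X. coeff [:X i:] k) \<in> exp_poly" for k
      by (cases k) (auto intro: exp_poly.var exp_poly_const)
    with False show ?thesis
      by (intro exI[of _ "\<lambda>n X. [:X i:]"] exI[of _ 1] conjI allI) auto
  qed
next
  case (add F G)
  from add.IH(1) obtain P D where P: "\<And>n X z. F n (X(j := z)) = poly (P n X) z"
      "\<And>i. (\<lambda>n X. coeff (P n X) i) \<in> exp_poly" "\<And>n X. degree (P n X) < D" by blast
  from add.IH(2) obtain P' D' where P': "\<And>n X z. G n (X(j := z)) = poly (P' n X) z"
      "\<And>i. (\<lambda>n X. coeff (P' n X) i) \<in> exp_poly" "\<And>n X. degree (P' n X) < D'" by blast
  have "degree (P n X + P' n X) < max D D'" for n X
    using degree_add_le_max[of "P n X" "P' n X"] P(3)[of n X] P'(3)[of n X] by linarith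
  with P P' show ?case
    by (intro exI[of _ "\<lambda>n X. P n X + P' n X"] exI[of _ "max D D'"] conjI allI)
       (auto intro: exp_poly.add simp del: fun_upd_apply)
next
  case (mult F G)
  from mult.IH(1) obtain P D where P: "\<And>n X z. F n (X(j := z)) = poly (P n X) z"
      "\<And>i. (\<lambda>n X. coeff (P n X) i) \<in> exp_poly" "\<And>n X. degree (P n X) < D" by blast
  from mult.IH(2) obtain P' D' where P': "\<And>n X z. G n (X(j := z)) = poly (P' n X) z"
      "\<And>i. (\<lambda>n X. coeff (P' n X) i) \<in> exp_poly" "\<And>n X. degree (P' n X) < D'" by blast
  have "degree (P n X * P' n X) < D + D'" for n X
    using degree_mult_le[of "P n X" "P' n X"] P(3)[of n X] P'(3)[of n X] by linarith
  with P P' show ?case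
    by (intro exI[of _ "\<lambda>n X. P n X * P' n X"] exI[of _ "D + D'"] conjI allI)
       (auto simp: coeff_mult intro!: exp_poly_sum exp_poly.mult simp del: fun_upd_apply)
qed

section \<open>Interpolation and Frobenius over a finite field\<close>

lemma degree_prod_list_le:
  fixes ps :: "'a::idom poly list"
  shows "(\<And>q. q \<in> set ps \<Longrightarrow> degree q \<le> 1) \<Longrightarrow> degree (prod_list ps) \<le> length ps"
proof (induction ps)
  case (Cons q ps)
  then show ?case using degree_mult_le[of q "prod_list ps"] by force
qed simp

lemma poly_prod_list: "poly (prod_list ps) z = (\<Prod>q\<leftarrow>ps. poly q z)"
  by (induction ps) auto

lemma poly_sum_coeff:
  fixes P :: "'a::comm_semiring_1 poly"
  assumes "degree P < D"
  shows "poly P z = (\<Sum>i<D. coeff P i * z ^ i)"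
  unfolding poly_altdef
  by (rule sum.mono_neutral_left) (use assms in \<open>auto simp: coeff_eq_0\<close>)

text \<open>\<open>L\<close> stands for the field with \<open>p ^ R\<close> elements inside
  \<open>'a\<close>. By \<open>weights\<close>, the numbers \<open>\<alpha> x r\<close> recover the
  coefficient of degree \<open>r\<close> of a polynomial of degree below \<open>p ^ R\<close> from
  its values on \<open>L\<close>.\<close>

locale frobenius_weights =
  fixes p R :: nat and L :: "'a::field set" and \<alpha> :: "'a \<Rightarrow> nat \<Rightarrow> 'a"
  assumes prime_p: "prime p" and char_p: "CHAR('a) = p" and finite_L: "finite L"
    and frobenius_L: "\<And>x. x \<in> L \<Longrightarrow> x ^ (p ^ R) = x"
    and weights: "\<And>w r. w < p ^ R \<Longrightarrow> (\<Sum>x\<in>L. x ^ w * \<alpha> x r) = (if w = r then 1 else 0)"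
begin

abbreviation (input) "Q \<equiv> p ^ R"

lemma frobenius_power_L: "x \<in> L \<Longrightarrow> x ^ (Q ^ a) = x"
  by (induction a) (simp_all add: power_mult frobenius_L)

lemma coeff_interpolation:
  assumes "degree q < Q"
  shows "coeff q r = (\<Sum>x\<in>L. const_fract (\<alpha> x r) * poly q (const_fract x))"
proof -
  have "(\<Sum>x\<in>L. const_fract (\<alpha> x r) * poly q (const_fract x)) =
      (\<Sum>x\<in>L. \<Sum>i<Q. coeff q i * const_fract (x ^ i * \<alpha> x r))"
    by (simp add: poly_sum_coeff[OF assms] sum_distrib_left const_fract_mult const_fract_power mult_ac)
  also have "\<dots> = (\<Sum>i<Q. coeff q i * const_fract (\<Sum>x\<in>L. x ^ i * \<alpha> x r))"
    by (subst sum.swap) (simp add: sum_distrib_left const_fract_sum)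
  also have "\<dots> = (\<Sum>i<Q. if i = r then coeff q i else 0)"
    by (intro sum.cong) (auto simp: weights)
  also have "\<dots> = coeff q r"
    using assms by (auto simp: coeff_eq_0)
  finally show ?thesis by simp
qed

lemma poly_interpolation:
  assumes "degree q < Q"
  shows "poly q z = (\<Sum>x\<in>L. (\<Sum>r<Q. const_fract (\<alpha> x r) * z ^ r) * poly q (const_fract x))"
proof -
  have "poly q z = (\<Sum>r<Q. coeff q r * z ^ r)"
    by (rule poly_sum_coeff[OF assms])
  also have "\<dots> = (\<Sum>r<Q. \<Sum>x\<in>L. const_fract (\<alpha> x r) * poly q (const_fract x) * z ^ r)"
    by (simp add: coeff_interpolation[OF assms] sum_distrib_right)
  finally have "poly q z = (\<Sum>r<Q. \<Sum>x\<in>L. const_fract (\<alpha> x r) * poly q (const_fract x) * z ^ r)" .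
  then show ?thesis
    by (subst (asm) sum.swap) (simp add: sum_distrib_left sum_distrib_right mult_ac)
qed

lemma sum_power_Q:
  fixes f :: "'b \<Rightarrow> 'a poly fract"
  shows "(\<Sum>i\<in>I. f i) ^ (Q ^ a) = (\<Sum>i\<in>I. f i ^ (Q ^ a))"
  by (rule freshmans_dream_sum'[where n = "R * a"])
     (simp_all add: CHAR_fract_poly char_p prime_p power_mult)

text \<open>Raising to the power \<open>Q ^ a\<close> is additive, fixes constants from
  \<open>L\<close> and only replaces \<open>indet\<close> by \<open>indet ^ (Q ^ a)\<close>. A sum
  of such exponents therefore gives a product of substitutions.\<close>

lemma linear_combination_power:
  assumes "\<And>k. k < D \<Longrightarrow> x k \<in> L"
  shows "(\<Sum>k<D. const_fract (x k) * indet ^ k) ^ (\<Sum>a\<leftarrow>as. Q ^ a) =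
    (\<Prod>a\<leftarrow>as. \<Sum>k<D. const_fract (x k) * (indet ^ (Q ^ a)) ^ k)"
proof (induction as)
  case (Cons a as)
  have "(\<Sum>k<D. const_fract (x k) * indet ^ k) ^ (Q ^ a) =
      (\<Sum>k<D. const_fract (x k) * (indet ^ (Q ^ a)) ^ k)"
    unfolding sum_power_Q
  proof (intro sum.cong refl)
    fix k assume "k \<in> {..<D}"
    then have "x k ^ (Q ^ a) = x k" using assms by (intro frobenius_power_L) auto
    then show "(const_fract (x k) * indet ^ k) ^ (Q ^ a) = const_fract (x k) * (indet ^ (Q ^ a)) ^ k"
      by (simp add: power_mult_distrib mult.commute flip: const_fract_power power_mult)
  qed
  with Cons show ?case by (simp add: power_add)
qed simp

end

text \<open>\<open>dg n\<close> may be any list of base-\<open>Q\<close> digit positions of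
  \<open>n\<close>, with repetition and of length below \<open>Q\<close>; the freedom in choosing it
  is used later to adapt it to the target set.\<close>

locale frobenius_digits = frobenius_weights +
  fixes A :: "nat set" and dg :: "nat \<Rightarrow> nat list"
  assumes pos_A: "\<And>n. n \<in> A \<Longrightarrow> n > 0"
    and digits: "\<And>n. n \<in> A \<Longrightarrow> n = (\<Sum>a\<leftarrow>dg n. Q ^ a)"
    and digits_less: "\<And>n. n \<in> A \<Longrightarrow> length (dg n) < Q"
begin

text \<open>Constants in \<open>L\<close> are fixed by the \<open>Q\<close>-Frobenius, so for coefficients in \<open>L\<close> the norm is an
  \<open>n\<close>-th power; as the norm has degree less than \<open>Q\<close> in each coefficient, interpolation over \<open>L\<close>
  frees the coefficients one after the other.\<close>
lemma norm_exp_poly_aux: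
  assumes "i \<le> D" "\<And>k. k < i \<Longrightarrow> g k \<in> exp_poly"
    and "\<And>k. i \<le> k \<Longrightarrow> k < D \<Longrightarrow> \<exists>x\<in>L. g k = (\<lambda>n X. const_fract x)"
  shows "\<exists>G\<in>exp_poly. \<forall>n\<in>A. \<forall>X.
    G n X = (\<Prod>a\<leftarrow>dg n. \<Sum>k<D. g k n X * (indet ^ (Q ^ a)) ^ k)"
  using assms
proof (induction i arbitrary: g)
  case 0
  then have "\<forall>k\<in>{..<D}. \<exists>x. x \<in> L \<and> g k = (\<lambda>n X. const_fract x)" by auto
  from bchoice[OF this] obtain x where
    x: "\<And>k. k < D \<Longrightarrow> x k \<in> L" "\<And>k. k < D \<Longrightarrow> g k = (\<lambda>n X. const_fract (x k))"
    by auto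
  define \<gamma> where "\<gamma> = (\<Sum>k<D. const_fract (x k) * indet ^ k)"
  have eq: "\<gamma> ^ n = (\<Prod>a\<leftarrow>dg n. \<Sum>k<D. g k n X * (indet ^ (Q ^ a)) ^ k)" if "n \<in> A" for n X
  proof -
    have "\<gamma> ^ n = \<gamma> ^ (\<Sum>a\<leftarrow>dg n. Q ^ a)"
      using digits[OF that] by simp
    then show ?thesis
      unfolding \<gamma>_def using linear_combination_power[of D x, OF x(1)] by (simp add: x(2))
  qed
  show ?case
  proof (cases "\<gamma> = 0")
    \<comment> \<open>Zero is no admissible base in \<open>exp_seq\<close>. As elements of
      \<open>A\<close> are positive, the zero sequence replaces \<open>\<gamma> ^ n\<close>.\<close>
    case True
    then show ?thesis
      using eq pos_A by (intro bexI[of _ "\<lambda>n X. 0"]) (auto simp: power_0_left exp_poly_const)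
  next
    case False
    then show ?thesis
      using eq by (intro bexI[of _ "\<lambda>n X. \<gamma> ^ n"] exp_poly.coeff exp_seq.power) auto
  qed
next
  case (Suc i)
  have "\<exists>G\<in>exp_poly. \<forall>n\<in>A. \<forall>X. G n X =
      (\<Prod>a\<leftarrow>dg n. \<Sum>k<D. (g(i := \<lambda>n X. const_fract x)) k n X * (indet ^ (Q ^ a)) ^ k)"
    if "x \<in> L" for x
    using Suc.prems that by (intro Suc.IH) auto
  then have "\<forall>x\<in>L. \<exists>G. G \<in> exp_poly \<and> (\<forall>n\<in>A. \<forall>X. G n X =
      (\<Prod>a\<leftarrow>dg n. \<Sum>k<D. (g(i := \<lambda>n X. const_fract x)) k n X * (indet ^ (Q ^ a)) ^ k))"
    by blast
  from bchoice[OF this] obtain G where G: "\<And>x. x \<in> L \<Longrightarrow> G x \<in> exp_poly"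
    "\<And>x n X. x \<in> L \<Longrightarrow> n \<in> A \<Longrightarrow> G x n X =
      (\<Prod>a\<leftarrow>dg n. \<Sum>k<D. (g(i := \<lambda>n X. const_fract x)) k n X * (indet ^ (Q ^ a)) ^ k)"
    by blast
  \<comment> \<open>\<open>G x\<close> is the norm with the \<open>i\<close>-th coefficient frozen
    at the constant \<open>x\<close>; \<open>H\<close> interpolates these norms and evaluates at the
    true coefficient \<open>g i n X\<close>.\<close>
  define H where "H = (\<lambda>n X. \<Sum>x\<in>L. (\<Sum>r<Q. const_fract (\<alpha> x r) * g i n X ^ r) * G x n X)"
  have "H \<in> exp_poly"
    unfolding H_def using G Suc.prems
    by (intro exp_poly_sum exp_poly.mult exp_poly_power exp_poly_const) auto
  moreover have "H n X = (\<Prod>a\<leftarrow>dg n. \<Sum>k<D. g k n X * (indet ^ (Q ^ a)) ^ k)" if n: "n \<in> A" for n X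
  proof -
    \<comment> \<open>The norm as a polynomial in its \<open>i\<close>-th coefficient, with one
      linear factor per digit.\<close>
    define q where "q = (\<Prod>a\<leftarrow>dg n. [:\<Sum>k\<in>{..<D} - {i}. g k n X * (indet ^ (Q ^ a)) ^ k,
        (indet ^ (Q ^ a)) ^ i:])"
    have q: "poly q z = (\<Prod>a\<leftarrow>dg n. \<Sum>k<D. (g(i := \<lambda>n X. z)) k n X * (indet ^ (Q ^ a)) ^ k)" for z
    proof -
      have "(\<Sum>k<D. (g(i := \<lambda>n X. z)) k n X * y ^ k) =
          (\<Sum>k\<in>{..<D} - {i}. g k n X * y ^ k) + z * y ^ i" for y
        using Suc.prems(1) by (subst sum.remove[of _ i]) (auto simp: add.commute)
      then show ?thesis by (simp add: q_def poly_prod_list o_def)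
    qed
    have "degree q \<le> length (dg n)"
      unfolding q_def by (rule order.trans[OF degree_prod_list_le]) auto
    then have deg: "degree q < Q" using digits_less[OF n] by simp
    have "H n X = (\<Sum>x\<in>L. (\<Sum>r<Q. const_fract (\<alpha> x r) * g i n X ^ r) * poly q (const_fract x))"
      unfolding H_def using G n by (intro sum.cong) (simp_all add: q)
    also have "\<dots> = poly q (g i n X)" by (rule poly_interpolation[OF deg, symmetric])
    also have "\<dots> = (\<Prod>a\<leftarrow>dg n. \<Sum>k<D. g k n X * (indet ^ (Q ^ a)) ^ k)"
      unfolding q by (intro arg_cong[of _ _ prod_list] map_cong refl sum.cong) auto
    finally show ?thesis .
  qed
  ultimately show ?case by blast
qed

lemma norm_exp_poly:
  fixes F :: "nat \<Rightarrow> (nat \<Rightarrow> 'a poly fract) \<Rightarrow> 'a poly fract"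
  assumes "F \<in> exp_poly"
  shows "\<exists>G\<in>exp_poly. \<forall>n\<in>A. \<forall>X. G n X = (\<Prod>a\<leftarrow>dg n. F n (X(j := indet ^ (Q ^ a))))"
proof -
  obtain P D where P: "\<And>n X z. F n (X(j := z)) = poly (P n X) z"
      "\<And>i. (\<lambda>n X. coeff (P n X) i) \<in> exp_poly" "\<And>n X. degree (P n X) < D"
    using exp_poly_as_poly[OF assms, of j] by blast
  have "F n (X(j := z)) = (\<Sum>k<D. coeff (P n X) k * z ^ k)" for n X z
    unfolding P(1) by (rule poly_sum_coeff[OF P(3)])
  \<comment> \<open>With \<open>i = D\<close> every coefficient is free, and the requirement that
    coefficients be constants from \<open>L\<close> is vacuous.\<close>
  moreover have "\<exists>G\<in>exp_poly. \<forall>n\<in>A. \<forall>X.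
      G n X = (\<Prod>a\<leftarrow>dg n. \<Sum>k<D. coeff (P n X) k * (indet ^ (Q ^ a)) ^ k)"
    by (rule norm_exp_poly_aux[of D D "\<lambda>k n X. coeff (P n X) k"]) (use P(2) in auto)
  ultimately show ?thesis by simp
qed

text \<open>A product over the digits vanishes iff one of its factors does, so taking the norm in a
  variable acts as an existential quantifier over digit positions.\<close>

lemma eliminate_variables:
  fixes F :: "nat \<Rightarrow> (nat \<Rightarrow> 'a poly fract) \<Rightarrow> 'a poly fract"
  assumes "finite J" "F \<in> exp_poly"
  shows "\<exists>G\<in>exp_poly. \<forall>n\<in>A. \<forall>X. G n X = 0 \<longleftrightarrow>
    (\<exists>b. (\<forall>j\<in>J. b j \<in> set (dg n)) \<and> F n (\<lambda>j. if j \<in> J then indet ^ (Q ^ b j) else X j) = 0)"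
  using assms(1)
proof (induction J rule: finite_induct)
  case empty
  show ?case using assms(2) by auto
next
  case (insert i J)
  then obtain G where G: "G \<in> exp_poly" "\<And>n X. n \<in> A \<Longrightarrow> G n X = 0 \<longleftrightarrow>
    (\<exists>b. (\<forall>j\<in>J. b j \<in> set (dg n)) \<and> F n (\<lambda>j. if j \<in> J then indet ^ (Q ^ b j) else X j) = 0)"
    by blast
  obtain H where H: "H \<in> exp_poly"
    "\<And>n X. n \<in> A \<Longrightarrow> H n X = (\<Prod>a\<leftarrow>dg n. G n (X(i := indet ^ (Q ^ a))))"
    using norm_exp_poly[OF G(1), of i] by blast
  have "H n X = 0 \<longleftrightarrow> (\<exists>b. (\<forall>j\<in>insert i J. b j \<in> set (dg n)) \<and>
      F n (\<lambda>j. if j \<in> insert i J then indet ^ (Q ^ b j) else X j) = 0)" (is "_ \<longleftrightarrow> ?r")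
    if n: "n \<in> A" for n X
  proof -
    have upd: "(\<lambda>j. if j \<in> J then indet ^ (Q ^ b j) else (X(i := indet ^ (Q ^ a))) j) =
        (\<lambda>j. if j \<in> insert i J then indet ^ (Q ^ (b(i := a)) j) else X j)" for a b
      using insert.hyps by auto
    have "H n X = 0 \<longleftrightarrow> (\<exists>a\<in>set (dg n). G n (X(i := indet ^ (Q ^ a))) = 0)"
      unfolding H(2)[OF n] prod_list_zero_iff by force
    also have "\<dots> \<longleftrightarrow> (\<exists>a\<in>set (dg n). \<exists>b. (\<forall>j\<in>J. b j \<in> set (dg n)) \<and>
        F n (\<lambda>j. if j \<in> insert i J then indet ^ (Q ^ (b(i := a)) j) else X j) = 0)"
      unfolding G(2)[OF n] upd ..
    also have "\<dots> \<longleftrightarrow> ?r"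
    proof
      assume "\<exists>a\<in>set (dg n). \<exists>b. (\<forall>j\<in>J. b j \<in> set (dg n)) \<and>
        F n (\<lambda>j. if j \<in> insert i J then indet ^ (Q ^ (b(i := a)) j) else X j) = 0"
      then obtain a b where ab: "a \<in> set (dg n)" "\<forall>j\<in>J. b j \<in> set (dg n)"
        "F n (\<lambda>j. if j \<in> insert i J then indet ^ (Q ^ (b(i := a)) j) else X j) = 0" by blast
      then show ?r by (intro exI[of _ "b(i := a)"]) auto
    next
      assume ?r
      then obtain b where b: "\<forall>j\<in>insert i J. b j \<in> set (dg n)"
        "F n (\<lambda>j. if j \<in> insert i J then indet ^ (Q ^ b j) else X j) = 0" by blast
      have "F n (\<lambda>j. if j \<in> insert i J then indet ^ (Q ^ (b(i := b i)) j) else X j) = 0"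
        unfolding fun_upd_triv by (rule b(2))
      with b(1) show "\<exists>a\<in>set (dg n). \<exists>b. (\<forall>j\<in>J. b j \<in> set (dg n)) \<and>
        F n (\<lambda>j. if j \<in> insert i J then indet ^ (Q ^ (b(i := a)) j) else X j) = 0"
        by blast
    qed
    finally show ?thesis .
  qed
  with H(1) show ?case by blast
qed

end

subsection \<open>Digit sums without carries\<close>

lemma prod_list_monic_linear:
  fixes y :: "'b \<Rightarrow> 'a::field"
  defines "P as \<equiv> \<Prod>a\<leftarrow>as. [:y a, 1:]"
  shows "degree (P as) = length as" "coeff (P as) (length as) = 1"
proof -
  have "degree (P as) = length as \<and> lead_coeff (P as) = 1"
  proof (induction as)
    case Nil
    show ?case by (simp add: P_def)
  next
    case (Cons a as)
    have P: "P (a # as) = [:y a, 1:] * P as" by (simp add: P_def)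
    have "P as \<noteq> 0" using Cons by auto
    then have "degree (P (a # as)) = Suc (length as)"
      unfolding P using Cons by (simp add: degree_mult_eq del: mult_pCons_left)
    moreover have "lead_coeff (P (a # as)) = 1"
      unfolding P lead_coeff_mult conjunct2[OF Cons] by simp
    ultimately show ?case by simp
  qed
  then have d: "degree (P as) = length as" and l: "lead_coeff (P as) = 1" by auto
  show "degree (P as) = length as" by (rule d)
  show "coeff (P as) (length as) = 1" using l unfolding d .
qed

text \<open>A case of Lucas' theorem. With \<open>P\<close> a power of the characteristic,
  \<open>(1 + X) ^ n\<close> equals \<open>(1 + X ^ P) ^ (n div P) * (1 + X) ^ m\<close>, whose
  first factor is \<open>1\<close> modulo \<open>X ^ P\<close>; as \<open>m < P\<close>, the
  coefficient of degree \<open>m\<close> is \<open>1\<close>.\<close>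

lemma binomial_mod_prime_power:
  assumes "prime CHAR('a::field)"
  shows "of_nat (n choose (n mod CHAR('a) ^ e)) = (1 :: 'a)"
proof -
  define P where "P = CHAR('a) ^ e"
  define m where "m = n mod P"
  have "P > 0" using assms by (simp add: P_def prime_gt_0_nat)
  then have "m < P" and "m \<le> n" by (simp_all add: m_def)
  have "[:1, 1:] ^ n = ([:1, 1:] ^ P) ^ (n div P) * [:1, 1:] ^ m"
    by (simp add: m_def flip: power_add power_mult)
  also have "[:1, 1:] ^ P = (1 + monom 1 P :: 'a poly)"
  proof -
    have "([:1, 1:] :: 'a poly) ^ P = (1 + monom 1 1) ^ P"
      by (simp add: monom_altdef one_pCons)
    also have "\<dots> = 1 + monom 1 P"
      using freshmans_dream'[of P e 1 "monom (1::'a) 1"] assms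
      by (simp add: P_def monom_power)
    finally show ?thesis .
  qed
  finally have eq: "[:1, 1:] ^ n = (1 + monom 1 P) ^ (n div P) * ([:1, 1:] ^ m :: 'a poly)" .
  have "\<exists>g. (1 + monom 1 P) ^ d = 1 + monom 1 P * (g :: 'a poly)" for d
  proof (induction d)
    case 0
    show ?case by (intro exI[of _ 0]) simp
  next
    case (Suc d)
    then obtain g :: "'a poly" where "(1 + monom 1 P) ^ d = 1 + monom 1 P * g" by blast
    then show ?case by (intro exI[of _ "1 + g + monom 1 P * g"]) (simp add: algebra_simps)
  qed
  then obtain g :: "'a poly" where "(1 + monom 1 P) ^ (n div P) = 1 + monom 1 P * g" by blast
  with eq have "[:1, 1:] ^ n = [:1, 1:] ^ m + monom 1 P * (g * [:1, 1:] ^ m)"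
    by (simp only: ring_distribs mult_1_left mult.assoc)
  then have "coeff ([:1, 1:] ^ n) m = coeff ([:1, 1:] ^ m + monom 1 P * (g * [:1, 1:] ^ m)) m"
    by simp
  then show ?thesis
    using \<open>m < P\<close> \<open>m \<le> n\<close> by (simp add: coeff_linear_poly_power coeff_monom_mult m_def P_def)
qed

lemma mod_power_eq_sum_digits:
  fixes p n :: nat
  shows "n mod p ^ e = (\<Sum>i<e. (n div p ^ i mod p) * p ^ i)"
proof (induction e)
  case (Suc e)
  have "n mod p ^ Suc e = p ^ e * (n div p ^ e mod p) + n mod p ^ e"
    by (simp only: power_Suc2 mod_mult2_eq)
  with Suc show ?case by simp
qed simp

lemma sum_list_concat_replicate:
  fixes f :: "'b \<Rightarrow> nat"
  shows "(\<Sum>a\<leftarrow>concat (map (\<lambda>i. replicate (u i) (v i)) is). f a) = (\<Sum>i\<leftarrow>is. u i * f (v i))"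
  by (induction "is") (simp_all add: sum_list_replicate)

lemma power_list_of_sum:
  fixes Q :: nat
  assumes "finite J"
  shows "\<exists>as. length as = sum c J \<and> (\<Sum>a\<leftarrow>as. Q ^ a) = (\<Sum>j\<in>J. c j * Q ^ b j) \<and>
    (\<forall>j\<in>J. c j \<ge> 1 \<longrightarrow> b j \<in> set as)"
  using assms
proof (induction J rule: finite_induct)
  case (insert i J)
  then obtain as where "length as = sum c J" "(\<Sum>a\<leftarrow>as. Q ^ a) = (\<Sum>j\<in>J. c j * Q ^ b j)"
    "\<forall>j\<in>J. c j \<ge> 1 \<longrightarrow> b j \<in> set as" by blast
  with insert.hyps show ?case
    by (intro exI[of _ "replicate (c i) (b i) @ as"]) (auto simp: sum_list_replicate)
qed simp

section \<open>Recognizing a bounded base-\<open>Q\<close> digit sum\<close>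

context frobenius_weights
begin

text \<open>The coefficient of degree \<open>r\<close> in \<open>x\<close> of the polynomial
  interpolating \<open>(indet + x) ^ n\<close> over \<open>L\<close>. If \<open>n\<close> is a sum
  of fewer than \<open>Q\<close> powers \<open>Q ^ a\<close>, it is an elementary symmetric
  polynomial in the \<open>indet ^ (Q ^ a)\<close>.\<close>

definition digit_coeff :: "nat \<Rightarrow> nat \<Rightarrow> 'a poly fract" where
  "digit_coeff r n = (\<Sum>x\<in>L. const_fract (\<alpha> x r) * (indet + const_fract x) ^ n)"

lemma indet_plus_const_nonzero: "indet + const_fract x \<noteq> 0"
  by (simp add: indet_def const_fract_def flip: to_fract_add)

lemma digit_coeff_exp_seq: "digit_coeff r \<in> exp_seq"
  unfolding digit_coeff_def [abs_def]
  by (intro exp_seq_sum exp_seq.mult exp_seq_const exp_seq.power indet_plus_const_nonzero)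

lemma digit_coeff_eq_coeff:
  assumes "length as < Q"
  shows "digit_coeff r (\<Sum>a\<leftarrow>as. Q ^ a) = coeff (\<Prod>a\<leftarrow>as. [:indet ^ (Q ^ a), 1:]) r"
proof -
  have *: "(indet + const_fract x) ^ (\<Sum>a\<leftarrow>as. Q ^ a) =
      poly (\<Prod>a\<leftarrow>as. [:indet ^ (Q ^ a), 1:]) (const_fract x)" if "x \<in> L" for x
  proof (induction as)
    case (Cons a as)
    have "(indet + const_fract x) ^ (Q ^ a) = indet ^ (Q ^ a) + const_fract x ^ (Q ^ a)"
      by (rule freshmans_dream'[where n = "R * a"])
         (simp_all add: CHAR_fract_poly char_p prime_p power_mult)
    also have "const_fract x ^ (Q ^ a) = const_fract x"
      using frobenius_power_L[OF that, of a] by (simp flip: const_fract_power)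
    finally show ?case using Cons by (simp add: power_add ring_distribs)
  qed simp
  have "degree (\<Prod>a\<leftarrow>as. [:indet ^ (Q ^ a), 1 :: 'a poly fract:]) < Q"
    using assms by (simp add: prod_list_monic_linear)
  from coeff_interpolation[OF this] show ?thesis
    unfolding digit_coeff_def by (simp add: *)
qed

text \<open>The binomial expansion turns \<open>digit_coeff r n\<close> into a polynomial in
  \<open>indet\<close>; the expression is its coefficient of degree \<open>n - k\<close>.\<close>

lemma digit_coeff_eq_0D:
  assumes "digit_coeff r n = 0" "k \<le> n"
  shows "of_nat (n choose k) * (\<Sum>x\<in>L. x ^ k * \<alpha> x r) = 0"
proof -
  define c where "c k = of_nat (n choose k) * (\<Sum>x\<in>L. x ^ k * \<alpha> x r)" for k
  have "digit_coeff r n =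
      (\<Sum>x\<in>L. \<Sum>k\<le>n. const_fract (of_nat (n choose k) * (x ^ k * \<alpha> x r)) * indet ^ (n - k))"
    unfolding digit_coeff_def add.commute[of indet] binomial_ring sum_distrib_left
    by (intro sum.cong) (simp_all add: const_fract_mult const_fract_power const_fract_of_nat mult_ac)
  also have "\<dots> = (\<Sum>k\<le>n. const_fract (c k) * indet ^ (n - k))"
    unfolding c_def by (subst sum.swap) (simp add: sum_distrib_left sum_distrib_right const_fract_sum)
  also have "\<dots> = to_fract (\<Sum>k\<le>n. monom (c k) (n - k))"
    unfolding to_fract_sum const_fract_indet_power ..
  finally have "digit_coeff r n = to_fract (\<Sum>k\<le>n. monom (c k) (n - k))" .
  with assms(1) have "(\<Sum>k\<le>n. monom (c k) (n - k)) = 0"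
    by (metis to_fract_eq_0_iff)
  then have "coeff (\<Sum>k\<le>n. monom (c k) (n - k)) (n - k) = 0" by simp
  moreover have "coeff (\<Sum>k\<le>n. monom (c k) (n - k)) (n - k) = (\<Sum>l\<le>n. if l = k then c k else 0)"
    unfolding coeff_sum using assms(2) by (intro sum.cong) auto
  ultimately show ?thesis using assms(2) by (simp add: c_def)
qed

lemma power_mod_R_L: "x \<in> L \<Longrightarrow> x ^ (p ^ i) = x ^ (p ^ (i mod R))"
proof -
  assume "x \<in> L"
  have "p ^ i = Q ^ (i div R) * p ^ (i mod R)"
    by (simp flip: power_mult power_add)
  then show ?thesis
    using frobenius_power_L[OF \<open>x \<in> L\<close>] by (simp add: power_mult)
qed

text \<open>The weight is the base-\<open>Q\<close> digit sum of \<open>n mod p ^ e\<close>; it grows with \<open>e\<close> in steps smaller than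
  \<open>Q - C\<close>, so it cannot jump over the range of indices where \<open>digit_coeff\<close> vanishes.\<close>
lemma weight_le:
  assumes "C \<ge> 1" "p * C < Q" "\<And>r. C < r \<Longrightarrow> r < Q \<Longrightarrow> digit_coeff r n = 0"
  shows "(\<Sum>i<e. (n div p ^ i mod p) * p ^ (i mod R)) \<le> C"
proof (induction e)
  case (Suc e)
  define w where "w = (\<Sum>i<Suc e. (n div p ^ i mod p) * p ^ (i mod R))"
  have p: "p > 1" using prime_p by (rule prime_gt_1_nat)
  have "R \<ge> 1" using assms(1,2) p by (cases R) auto
  then have Q: "Q = p * p ^ (R - 1)" by (cases R) auto
  have "n div p ^ e mod p < p" using p by simp
  then have "n div p ^ e mod p \<le> p - 1" by linarith
  moreover have "p ^ (e mod R) \<le> p ^ (R - 1)"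
  proof (rule power_increasing)
    have "e mod R < R" using \<open>R \<ge> 1\<close> by simp
    then show "e mod R \<le> R - 1" by linarith
  qed (use p in simp)
  ultimately have "(n div p ^ e mod p) * p ^ (e mod R) \<le> (p - 1) * p ^ (R - 1)"
    by (rule mult_le_mono)
  with Suc have "w \<le> C + (p - 1) * p ^ (R - 1)" by (simp add: w_def)
  \<comment> \<open>Since \<open>Q = p * p ^ (R - 1)\<close>, the assumption
    \<open>p * C < Q\<close> amounts to \<open>C < p ^ (R - 1)\<close>.\<close>
  also have "\<dots> < p ^ (R - 1) + (p - 1) * p ^ (R - 1)" using assms(2) p by (simp add: Q)
  also have "\<dots> = Q" using p by (simp add: Q algebra_simps)
  finally have "w < Q" .
  show ?case
  proof (rule ccontr)
    assume "\<not> ?case"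
    then have "C < w" by (simp add: w_def)
    \<comment> \<open>Truncating \<open>n\<close> to its lowest \<open>Suc e\<close> digits gives an
      exponent that acts on \<open>L\<close> like \<open>w\<close>. In
      \<open>digit_coeff w n\<close> the coefficient belonging to this \<open>k\<close> is then
      \<open>1\<close>, although \<open>C < w < Q\<close> forces it to vanish.\<close>
    define k where "k = n mod p ^ Suc e"
    have "x ^ k = x ^ w" if "x \<in> L" for x
    proof -
      have "x ^ k = (\<Prod>i<Suc e. (x ^ (p ^ i)) ^ (n div p ^ i mod p))"
        unfolding k_def mod_power_eq_sum_digits power_sum by (simp only: mult.commute power_mult)
      also have "\<dots> = (\<Prod>i<Suc e. (x ^ (p ^ (i mod R))) ^ (n div p ^ i mod p))"
        using power_mod_R_L[OF that] by simp
      also have "\<dots> = x ^ w"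
        unfolding w_def power_sum by (simp only: mult.commute power_mult)
      finally show ?thesis .
    qed
    then have "(\<Sum>x\<in>L. x ^ k * \<alpha> x w) = 1"
      using weights[OF \<open>w < Q\<close>, of w] by simp
    moreover have "of_nat (n choose k) = (1 :: 'a)"
      using binomial_mod_prime_power[where 'a = 'a, of n "Suc e"] prime_p
      unfolding char_p k_def by simp
    moreover have "k \<le> n" by (simp add: k_def)
    ultimately show False
      using digit_coeff_eq_0D[OF assms(3)[OF \<open>C < w\<close> \<open>w < Q\<close>], of k] by simp
  qed
qed simp

lemma digit_sum_le:
  assumes "C \<ge> 1" "p * C < Q" "\<And>r. C < r \<Longrightarrow> r < Q \<Longrightarrow> digit_coeff r n = 0"
  shows "\<exists>as. length as \<le> C \<and> n = (\<Sum>a\<leftarrow>as. Q ^ a)"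
proof -
  \<comment> \<open>The base-\<open>p\<close> position \<open>i\<close> belongs to the
    base-\<open>Q\<close> position \<open>i div R\<close>, with weight \<open>p ^ (i mod R)\<close>.
    As \<open>n < p ^ n\<close>, the positions below \<open>n\<close> suffice.\<close>
  define as where "as = concat (map (\<lambda>i. replicate ((n div p ^ i mod p) * p ^ (i mod R)) (i div R)) [0..<n])"
  have "n < p ^ n" using prime_gt_1_nat[OF prime_p] by (simp add: power_gt_expt)
  then have "n = (\<Sum>i<n. (n div p ^ i mod p) * p ^ i)"
    using mod_power_eq_sum_digits[of n p n] by simp
  also have "\<dots> = (\<Sum>i<n. (n div p ^ i mod p) * p ^ (i mod R) * Q ^ (i div R))"
    by (simp add: mult.assoc flip: power_mult power_add)
  also have "\<dots> = (\<Sum>a\<leftarrow>as. Q ^ a)"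
    unfolding as_def sum_list_concat_replicate
    by (simp add: interv_sum_list_conv_sum_set_nat atLeast0LessThan)
  finally have "n = (\<Sum>a\<leftarrow>as. Q ^ a)" .
  moreover have "length as = (\<Sum>i<n. (n div p ^ i mod p) * p ^ (i mod R))"
    by (simp add: as_def length_concat o_def interv_sum_list_conv_sum_set_nat atLeast0LessThan)
  ultimately show ?thesis using weight_le[OF assms] by metis
qed

text \<open>Conditions on \<open>digit_coeff\<close> confine \<open>n\<close> to a set
  \<open>N\<close> where norms over the digits are available; on \<open>N\<close>, the existence of
  the exponents becomes one equation.\<close>

lemma exp_zero_power_sums:
  fixes c :: "nat \<Rightarrow> nat"
  assumes "finite J" "J \<noteq> {}" "\<And>j. j \<in> J \<Longrightarrow> c j \<ge> 1" "p * sum c J < Q"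
  shows "exp_zero TYPE('a poly fract) {n. \<exists>b. n = (\<Sum>j\<in>J. c j * Q ^ b j)}" (is "exp_zero _ ?S")
proof -
  define C where "C = sum c J"
  have "C \<ge> 1"
  proof -
    obtain j where "j \<in> J" using assms(2) by blast
    then have "c j \<le> C" unfolding C_def using assms(1) by (intro member_le_sum) auto
    with assms(3)[OF \<open>j \<in> J\<close>] show ?thesis by simp
  qed
  have "C < Q" using assms(4) prime_gt_1_nat[OF prime_p] unfolding C_def
    by (metis le_less_trans mult_le_mono1 nat_mult_1 less_imp_le_nat)
  \<comment> \<open>The vanishing conditions bound the digit sum by \<open>C\<close>. The last
    equation holds for sums of exactly \<open>C\<close> powers and rules out \<open>n = 0\<close>,
    because \<open>C\<close> is positive.\<close>
  define N where "N = {n. (\<forall>r\<in>{C<..<Q}. digit_coeff r n = 0)} \<inter> {n. digit_coeff C n = 1}"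
  have N: "exp_zero TYPE('a poly fract) N"
    unfolding N_def
    by (intro exp_zero_Int exp_zero_Ball exp_zero_eq digit_coeff_exp_seq exp_seq_const) simp
  have "?S \<subseteq> N"
  proof
    fix n assume "n \<in> ?S"
    then obtain b where b: "n = (\<Sum>j\<in>J. c j * Q ^ b j)" by blast
    obtain as where as: "length as = C" "(\<Sum>a\<leftarrow>as. Q ^ a) = n"
      using power_list_of_sum[OF assms(1), of c Q b] b unfolding C_def by metis
    have "digit_coeff r n = coeff (\<Prod>a\<leftarrow>as. [:indet ^ (Q ^ a), 1:]) r" for r
      using digit_coeff_eq_coeff[of as r] as \<open>C < Q\<close> by simp
    moreover have "degree (\<Prod>a\<leftarrow>as. [:indet ^ (Q ^ a), 1 :: 'a poly fract:]) = C"
      "coeff (\<Prod>a\<leftarrow>as. [:indet ^ (Q ^ a), 1 :: 'a poly fract:]) C = 1"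
      unfolding as(1) [symmetric] by (rule prod_list_monic_linear)+
    ultimately show "n \<in> N" unfolding N_def by (simp add: coeff_eq_0)
  qed
  have pos: "n > 0" if "n \<in> N" for n
  proof (rule ccontr)
    assume "\<not> n > 0"
    then have "digit_coeff C n = const_fract (\<Sum>x\<in>L. x ^ 0 * \<alpha> x C)"
      by (simp add: digit_coeff_def const_fract_sum)
    also have "(\<Sum>x\<in>L. x ^ 0 * \<alpha> x C) = (if 0 = C then 1 else 0)"
      using \<open>C < Q\<close> by (intro weights) linarith
    also have "const_fract \<dots> = 0" using \<open>C \<ge> 1\<close> by simp
    finally show False using that by (simp add: N_def)
  qed
  \<comment> \<open>For \<open>n\<close> in the target set the list is built from a representation
    of \<open>n\<close>, so it contains the exponents to be found and no uniqueness of digits is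
    needed. For other \<open>n\<close> any short list will do.\<close>
  have "\<exists>as. n = (\<Sum>a\<leftarrow>as. Q ^ a) \<and> length as < Q \<and>
      (n \<in> ?S \<longrightarrow> (\<exists>b. n = (\<Sum>j\<in>J. c j * Q ^ b j) \<and> (\<forall>j\<in>J. b j \<in> set as)))" if "n \<in> N" for n
  proof (cases "n \<in> ?S")
    case True
    then obtain b where b: "n = (\<Sum>j\<in>J. c j * Q ^ b j)" by blast
    obtain as where "length as = C" "(\<Sum>a\<leftarrow>as. Q ^ a) = n" "\<forall>j\<in>J. b j \<in> set as"
      using power_list_of_sum[OF assms(1), of c Q b] assms(3) unfolding C_def b by blast
    with b \<open>C < Q\<close> show ?thesis by (intro exI[of _ as] conjI impI exI[of _ b]) simp_all
  next
    case False
    have "digit_coeff r n = 0" if "C < r" "r < Q" for r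
      using that \<open>n \<in> N\<close> by (simp add: N_def)
    then obtain as where "length as \<le> C" "n = (\<Sum>a\<leftarrow>as. Q ^ a)"
      using digit_sum_le[OF \<open>C \<ge> 1\<close>] assms(4) unfolding C_def by blast
    with False \<open>C < Q\<close> show ?thesis by (intro exI[of _ as]) auto
  qed
  then have "\<forall>n\<in>N. \<exists>as. n = (\<Sum>a\<leftarrow>as. Q ^ a) \<and> length as < Q \<and>
      (n \<in> ?S \<longrightarrow> (\<exists>b. n = (\<Sum>j\<in>J. c j * Q ^ b j) \<and> (\<forall>j\<in>J. b j \<in> set as)))"
    by blast
  from bchoice[OF this] obtain dg where dg: "\<And>n. n \<in> N \<Longrightarrow> n = (\<Sum>a\<leftarrow>dg n. Q ^ a)"
    "\<And>n. n \<in> N \<Longrightarrow> length (dg n) < Q"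
    "\<And>n. n \<in> N \<Longrightarrow> n \<in> ?S \<Longrightarrow> \<exists>b. n = (\<Sum>j\<in>J. c j * Q ^ b j) \<and> (\<forall>j\<in>J. b j \<in> set (dg n))"
    by blast
  interpret frobenius_digits p R L \<alpha> N dg
    by unfold_locales (fact pos dg)+
  \<comment> \<open>Powers of \<open>indet\<close> are pairwise distinct, so the additive equation
    for \<open>n\<close> can be stated multiplicatively, with \<open>X j\<close> standing for
    \<open>indet ^ (Q ^ b j)\<close>.\<close>
  have "(\<lambda>n X. indet ^ n - (\<Prod>j\<in>J. X j ^ c j)) \<in> exp_poly"
    by (intro exp_poly_diff exp_poly_prod exp_poly_power exp_poly.var exp_poly.coeff exp_seq.power) simp
  from eliminate_variables[OF assms(1) this]
  obtain G :: "nat \<Rightarrow> (nat \<Rightarrow> 'a poly fract) \<Rightarrow> 'a poly fract" where G: "G \<in> exp_poly"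
    "\<And>n X. n \<in> N \<Longrightarrow> G n X = 0 \<longleftrightarrow> (\<exists>b. (\<forall>j\<in>J. b j \<in> set (dg n)) \<and>
      indet ^ n - (\<Prod>j\<in>J. (if j \<in> J then indet ^ (Q ^ b j) else X j) ^ c j) = 0)"
    by blast
  \<comment> \<open>No variable outside \<open>J\<close> matters, so the assignment
    \<open>\<lambda>_. 0\<close> is an arbitrary default.\<close>
  have "G n (\<lambda>_. 0) = 0 \<longleftrightarrow> n \<in> ?S" if n: "n \<in> N" for n
  proof -
    have "(\<Prod>j\<in>J. (if j \<in> J then indet ^ (Q ^ b j) else 0) ^ c j) =
        (indet :: 'a poly fract) ^ (\<Sum>j\<in>J. c j * Q ^ b j)" for b
      by (simp add: power_sum mult.commute flip: power_mult)
    then have "G n (\<lambda>_. 0) = 0 \<longleftrightarrow> (\<exists>b. (\<forall>j\<in>J. b j \<in> set (dg n)) \<and> n = (\<Sum>j\<in>J. c j * Q ^ b j))"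
      unfolding G(2)[OF n] by simp
    also have "\<dots> \<longleftrightarrow> n \<in> ?S" using dg(3)[OF n] by blast
    finally show ?thesis .
  qed
  with \<open>?S \<subseteq> N\<close> have "?S = N \<inter> {n. G n (\<lambda>_. 0) = 0}" by blast
  moreover have "exp_zero TYPE('a poly fract) (N \<inter> {n. G n (\<lambda>_. 0) = 0})"
    by (intro exp_zero_Int N exp_zero_eq[OF exp_poly_eval[OF G(1)] exp_seq_const])
  ultimately show ?thesis by simp
qed

end

subsection \<open>Residue windows\<close>

text \<open>The roots of \<open>x ^ (p ^ R) = x\<close> serve as \<open>L\<close>: there are
  \<open>p ^ R\<close> of them, so interpolation provides the weights. For empty \<open>J\<close>
  the set is \<open>{0}\<close>.\<close>

lemma exp_zero_no_carry:
  fixes c :: "nat \<Rightarrow> nat"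
  assumes "prime p" "CHAR('a::alg_closed_field) = p" "finite J" "\<And>j. j \<in> J \<Longrightarrow> c j \<ge> 1"
    and "p * sum c J < p ^ R" "R \<ge> 1"
  shows "exp_zero TYPE('a poly fract) {n. \<exists>b. n = (\<Sum>j\<in>J. c j * (p ^ R) ^ b j)}"
proof (cases "J = {}")
  case True
  then show ?thesis using exp_zero_singleton[of 0] by simp
next
  case False
  define L where "L = {x::'a. x ^ (p ^ R) = x}"
  have "p ^ R \<ge> p ^ 1"
    using prime_ge_1_nat[OF assms(1)] assms(6) by (intro power_increasing) auto
  then have "p ^ R \<ge> 2" using prime_ge_2_nat[OF assms(1)] by simp
  moreover have "of_nat (p ^ R) = (0 :: 'a)"
    using assms(2,6) by (simp add: of_nat_eq_0_iff_char_dvd dvd_power)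
  ultimately have card: "card L = p ^ R"
    unfolding L_def by (intro card_roots_power_eq_self)
  with \<open>p ^ R \<ge> 2\<close> have "card L > 0" by linarith
  then have "finite L" by (rule card_ge_0_finite)
  then obtain \<alpha> where \<alpha>: "\<forall>w<card L. \<forall>r. (\<Sum>x\<in>L. x ^ w * \<alpha> x r) = (if w = r then 1 else 0)"
    using interpolation_weights by blast
  interpret frobenius_weights p R L \<alpha>
    by unfold_locales (use assms \<open>finite L\<close> \<alpha> card in \<open>auto simp: L_def\<close>)
  show ?thesis using assms False by (intro exp_zero_power_sums)
qed

text \<open>Pigeonhole: the residues modulo \<open>g * Suc m\<close> form \<open>Suc m\<close>
  blocks of length \<open>g\<close>, and at most \<open>m\<close> blocks are hit.\<close>

lemma residue_gap:
  fixes u :: "nat \<Rightarrow> nat"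
  assumes "finite J" "card J \<le> m" "g \<ge> 1"
  shows "\<exists>i\<le>m. \<forall>j\<in>J. u j mod (g * Suc m) div g \<noteq> i"
proof -
  let ?f = "\<lambda>j. u j mod (g * Suc m) div g"
  have "card (?f ` J) \<le> m" using card_image_le[OF assms(1), of ?f] assms(2) by simp
  then have "\<not> {..m} \<subseteq> ?f ` J" using card_mono[of "?f ` J" "{..m}"] assms(1) by auto
  then show ?thesis by auto
qed

text \<open>Above the end of an empty window, the cofactor is a sum of coefficients
  \<open>c j * q ^ b j\<close> times powers of \<open>q ^ r\<close>, without carries. Finitely many
  choices of cut, residues and remainder cover the set.\<close>

lemma exp_zero_prime_power_sums:
  fixes c :: "nat \<Rightarrow> nat"
  assumes p: "prime p" "CHAR('a::alg_closed_field) = p" and "v \<ge> 1"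
    and J0: "finite J0" "\<And>j. j \<in> J0 \<Longrightarrow> c j \<ge> 1"
  shows "exp_zero TYPE('a poly fract) {n. \<exists>u. n = (\<Sum>j\<in>J0. c j * (p ^ v) ^ u j)}"
    (is "exp_zero _ ?S")
proof -
  define q where "q = p ^ v"
  define m where "m = card J0"
  \<comment> \<open>The window length is chosen so that \<open>q ^ g\<close> exceeds
    \<open>p * sum c J0\<close>; an empty window of this length then absorbs all carries.\<close>
  define g where "g = Suc (p * sum c J0)"
  define r where "r = g * Suc m"
  have p1: "p > 1" using p(1) by (rule prime_gt_1_nat)
  have q: "q > 1" unfolding q_def using p1 assms(3) by (intro one_less_power) auto
  have g: "p * sum c J0 < q ^ g"
  proof -
    have "g < q ^ g" using q by (simp add: power_gt_expt)
    then show ?thesis by (simp add: g_def)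
  qed
  \<comment> \<open>\<open>\<beta>\<close> is the cut, \<open>J\<close> the indices with exponent at
    or above it, \<open>b\<close> their shifted residues modulo \<open>r\<close>, and
    \<open>r0\<close> the contribution of the other indices.\<close>
  define Z where "Z \<beta> J b r0 =
    {n. n mod q ^ \<beta> = r0 \<and> (\<exists>a. n div q ^ \<beta> = (\<Sum>j\<in>J. c j * q ^ b j * (q ^ r) ^ a j))}"
    for \<beta> J and b :: "nat \<Rightarrow> nat" and r0
  have Z: "exp_zero TYPE('a poly fract) (Z \<beta> J b r0)"
    if J: "J \<subseteq> J0" and b: "p * (\<Sum>j\<in>J. c j * q ^ b j) < q ^ r" for \<beta> J b r0
  proof -
    have "c j * q ^ b j \<ge> 1" if "j \<in> J" for j
      using that J J0(2)[of j] q by (auto simp: Suc_le_eq)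
    moreover have "v * r \<ge> 1" using assms(3) by (simp add: r_def g_def)
    ultimately have "exp_zero TYPE('a poly fract)
        {n. \<exists>a. n = (\<Sum>j\<in>J. c j * q ^ b j * (p ^ (v * r)) ^ a j)}"
      using J J0(1) b p by (intro exp_zero_no_carry) (auto simp: q_def power_mult finite_subset)
    then have "exp_zero TYPE('a poly fract)
        {n. n div q ^ \<beta> \<in> {n. \<exists>a. n = (\<Sum>j\<in>J. c j * q ^ b j * (p ^ (v * r)) ^ a j)}}"
      by (intro exp_zero_div[where e = "v * \<beta>"])
         (simp_all add: CHAR_fract_poly p q_def power_mult)
    moreover have "exp_zero TYPE('a poly fract) {n. n mod q ^ \<beta> = r0}"
      using q by (intro exp_zero_mod) (simp add: Suc_le_eq)
    ultimately have "exp_zero TYPE('a poly fract) ({n. n mod q ^ \<beta> = r0} \<inter>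
        {n. n div q ^ \<beta> \<in> {n. \<exists>a. n = (\<Sum>j\<in>J. c j * q ^ b j * (p ^ (v * r)) ^ a j)}})"
      by (rule exp_zero_Int[rotated])
    then show ?thesis
      by (simp add: Z_def Collect_conj_eq q_def power_mult)
  qed
  \<comment> \<open>Extensional functions keep the choices of \<open>b\<close> finite in
    number.\<close>
  define I where "I = {..r} \<times> Pow J0 \<times> (J0 \<rightarrow>\<^sub>E {..<r}) \<times> {..<q ^ r}"
  \<comment> \<open>Keeping only pieces inside the target set makes one inclusion immediate.\<close>
  define \<Z> where "\<Z> = {Z \<beta> J b r0 |\<beta> J b r0. (\<beta>, J, b, r0) \<in> I \<and>
    p * (\<Sum>j\<in>J. c j * q ^ b j) < q ^ r \<and> Z \<beta> J b r0 \<subseteq> ?S}"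
  have "finite I" unfolding I_def using J0(1) by (intro finite_cartesian_product finite_PiE) auto
  moreover have "\<Z> \<subseteq> (\<lambda>(\<beta>, J, b, r0). Z \<beta> J b r0) ` I" unfolding \<Z>_def by force
  ultimately have "finite \<Z>" by (rule finite_surj)
  then have "exp_zero TYPE('a poly fract) (\<Union>\<Z>)"
  proof (rule exp_zero_Union)
    fix S assume "S \<in> \<Z>"
    then obtain \<beta> J b r0 where "S = Z \<beta> J b r0" "J \<subseteq> J0" "p * (\<Sum>j\<in>J. c j * q ^ b j) < q ^ r"
      unfolding \<Z>_def I_def by blast
    then show "exp_zero TYPE('a poly fract) S" using Z by simp
  qed
  moreover have "\<Union>\<Z> = ?S"
  proof
    show "\<Union>\<Z> \<subseteq> ?S" unfolding \<Z>_def by blast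
    show "?S \<subseteq> \<Union>\<Z>"
    proof
      fix n assume "n \<in> ?S"
      then obtain u where u: "n = (\<Sum>j\<in>J0. c j * q ^ u j)" unfolding q_def by blast
      obtain i where i: "i \<le> m" "\<And>j. j \<in> J0 \<Longrightarrow> u j mod r div g \<noteq> i"
        using residue_gap[OF J0(1), of m g u] unfolding r_def m_def g_def by auto
      define \<beta> where "\<beta> = g * Suc i"
      define J where "J = {j \<in> J0. u j \<ge> \<beta>}"
      define b where "b = (\<lambda>j. if j \<in> J0 then (u j - \<beta>) mod r else undefined)"
      define r0 where "r0 = (\<Sum>j\<in>J0 - J. c j * q ^ u j)"
      have "\<beta> \<le> r" unfolding \<beta>_def r_def using i(1) by (intro mult_le_mono) auto
      have "g \<le> \<beta>" unfolding \<beta>_def by simp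
      have window: "\<not> (g * i \<le> u j mod r \<and> u j mod r < \<beta>)" if "j \<in> J0" for j
      proof
        assume "g * i \<le> u j mod r \<and> u j mod r < \<beta>"
        then have "u j mod r div g = i" unfolding \<beta>_def by (intro div_nat_eqI) auto
        with i(2)[OF that] show False by contradiction
      qed
      have \<beta>: "\<beta> = g * i + g" unfolding \<beta>_def by simp
      \<comment> \<open>The block just below \<open>\<beta>\<close> is empty and
        \<open>\<beta> \<le> r\<close>, so an exponent below the cut equals its residue and lies
        below the block.\<close>
      have low: "u j < \<beta> - g" if "j \<in> J0 - J" for j
      proof -
        have "u j < \<beta>" "u j mod r = u j"
          using that \<open>\<beta> \<le> r\<close> by (auto simp: J_def)
        with window[of j] that \<beta> show ?thesis by auto
      qed
      \<comment> \<open>Shifting by \<open>\<beta>\<close> moves the empty block to the top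
        \<open>g\<close> residues modulo \<open>r\<close>. A residue \<open>x\<close> below the
        block wraps around, which is possible as then \<open>t > 0\<close>.\<close>
      have high: "(u j - \<beta>) mod r < r - g" if "j \<in> J" for j
      proof -
        define x t where "x = u j mod r" and "t = u j div r"
        have ut: "u j = r * t + x" by (simp add: x_def t_def)
        have "u j \<ge> \<beta>" using that by (simp add: J_def)
        have "x < r" unfolding x_def by (rule mod_less_divisor) (simp add: r_def g_def)
        have "x < g * i \<or> x \<ge> \<beta>"
          using window[of j] that by (auto simp: J_def x_def)
        then show ?thesis
        proof
          assume "x \<ge> \<beta>"
          then have "u j - \<beta> = r * t + (x - \<beta>)" using ut by simp
          then have "(u j - \<beta>) mod r = (x - \<beta>) mod r" by (simp only: mod_mult_self4)
          then show ?thesis using \<open>x \<ge> \<beta>\<close> \<open>x < r\<close> \<open>g \<le> \<beta>\<close> by simp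
        next
          assume x: "x < g * i"
          have "t \<noteq> 0"
          proof
            assume "t = 0"
            with ut \<open>u j \<ge> \<beta>\<close> x \<beta> show False by simp
          qed
          then obtain t' where "t = Suc t'" by (cases t) auto
          then have "u j - \<beta> = r * t' + (x + r - \<beta>)" using ut \<open>\<beta> \<le> r\<close> by simp
          then have "(u j - \<beta>) mod r = (x + r - \<beta>) mod r" by (simp only: mod_mult_self4)
          then show ?thesis using x \<beta> \<open>\<beta> \<le> r\<close> by simp
        qed
      qed
      \<comment> \<open>The \<open>g\<close> free places absorb the factor
        \<open>p * sum c J0\<close>. This serves for the remainder with \<open>N = \<beta>\<close>
        and for the coefficients of the cofactor with \<open>N = r\<close>.\<close>
      have small: "p * (\<Sum>j\<in>J. c j * q ^ e j) < q ^ N"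
        if "J \<subseteq> J0" "g \<le> N" "\<And>j. j \<in> J \<Longrightarrow> e j < N - g" for J e N
      proof -
        have "(\<Sum>j\<in>J. c j * q ^ e j) \<le> (\<Sum>j\<in>J. c j * q ^ (N - g))"
          using that q by (intro sum_mono mult_le_mono power_increasing) (auto intro: less_imp_le)
        also have "\<dots> = sum c J * q ^ (N - g)" by (simp add: sum_distrib_right)
        also have "\<dots> \<le> sum c J0 * q ^ (N - g)"
          using that(1) J0(1) by (intro mult_le_mono sum_mono2) auto
        finally have "p * (\<Sum>j\<in>J. c j * q ^ e j) \<le> (p * sum c J0) * q ^ (N - g)"
          using p1 by simp
        also have "\<dots> < q ^ g * q ^ (N - g)" using g q by simp
        also have "\<dots> = q ^ N" using that(2) by (simp flip: power_add)
        finally show ?thesis .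
      qed
      have "r0 \<le> p * r0" using p1 by simp
      also have "p * r0 < q ^ \<beta>" unfolding r0_def using low \<open>g \<le> \<beta>\<close> by (intro small) auto
      finally have "r0 < q ^ \<beta>" .
      have bound: "p * (\<Sum>j\<in>J. c j * q ^ b j) < q ^ r"
        using high \<open>g \<le> \<beta>\<close> \<open>\<beta> \<le> r\<close> by (intro small) (auto simp: J_def b_def)
      have split: "(\<Sum>j\<in>J0. f j) = (\<Sum>j\<in>J. f j) + (\<Sum>j\<in>J0 - J. f j)" for f :: "nat \<Rightarrow> nat"
        using sum.subset_diff[of J J0 f] J0(1) by (auto simp: J_def)
      have sub: "Z \<beta> J b r0 \<subseteq> ?S"
      proof
        fix n' assume "n' \<in> Z \<beta> J b r0"
        then obtain a where a: "n' mod q ^ \<beta> = r0"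
          "n' div q ^ \<beta> = (\<Sum>j\<in>J. c j * q ^ b j * (q ^ r) ^ a j)"
          unfolding Z_def by blast
        \<comment> \<open>The remainder \<open>r0\<close> comes from \<open>n\<close>, so the low
          indices reuse the exponents of \<open>n\<close> and only the high ones vary.\<close>
        define u' where "u' j = (if j \<in> J then \<beta> + b j + r * a j else u j)" for j
        have "n' = q ^ \<beta> * (n' div q ^ \<beta>) + n' mod q ^ \<beta>" by simp
        also have "\<dots> = (\<Sum>j\<in>J. c j * q ^ u' j) + (\<Sum>j\<in>J0 - J. c j * q ^ u' j)"
          unfolding a r0_def by (simp add: sum_distrib_left u'_def power_add power_mult mult_ac)
        finally have "n' = (\<Sum>j\<in>J0. c j * q ^ u' j)" unfolding split .
        then show "n' \<in> ?S" unfolding q_def by blast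
      qed
      have mem: "n \<in> Z \<beta> J b r0"
      proof -
        define s where "s = (\<Sum>j\<in>J. c j * q ^ b j * (q ^ r) ^ ((u j - \<beta>) div r))"
        have "q ^ u j = q ^ \<beta> * (q ^ b j * (q ^ r) ^ ((u j - \<beta>) div r))" if "j \<in> J" for j
        proof -
          have "u j = \<beta> + (b j + r * ((u j - \<beta>) div r))"
            using that by (simp add: J_def b_def)
          then show ?thesis by (metis power_add power_mult)
        qed
        then have "n = q ^ \<beta> * s + r0"
          unfolding u split r0_def s_def by (simp add: sum_distrib_left mult_ac)
        then have "n mod q ^ \<beta> = r0" "n div q ^ \<beta> = s"
          using \<open>r0 < q ^ \<beta>\<close> q by simp_all
        then show ?thesis unfolding Z_def s_def by auto
      qed
      have "q ^ \<beta> \<le> q ^ r" using q \<open>\<beta> \<le> r\<close> by (intro power_increasing) auto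
      then have "r0 < q ^ r" using \<open>r0 < q ^ \<beta>\<close> by simp
      moreover have "b \<in> J0 \<rightarrow>\<^sub>E {..<r}"
        unfolding b_def by (auto simp: r_def g_def)
      ultimately have "(\<beta>, J, b, r0) \<in> I"
        using \<open>\<beta> \<le> r\<close> unfolding I_def by (auto simp: J_def)
      with bound sub have "Z \<beta> J b r0 \<in> \<Z>" unfolding \<Z>_def by blast
      with mem show "n \<in> \<Union>\<Z>" by blast
    qed
  qed
  ultimately show ?thesis by simp
qed

theorem theorem3p1:
  fixes p k m :: nat and c :: "nat \<Rightarrow> nat"
  assumes "prime p" and "k \<ge> 1" and "m \<ge> 1"
    and "\<forall>j\<in>{1..m}. c j \<ge> 1"
    and "CHAR('a::alg_closed_field) = p"
    and "\<forall>x::'a. \<exists>P::'a poly. P \<noteq> 0 \<and> (\<forall>i. coeff P i \<in> range of_nat) \<and> poly P x = 0"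
  shows "dml_split_torus TYPE('a poly fract)
           {\<Sum>j=1..m. c j * (p ^ k) ^ (n j) | n :: nat \<Rightarrow> nat. True}"
proof -
  have "exp_zero TYPE('a poly fract) {n. \<exists>u. n = (\<Sum>j=1..m. c j * (p ^ k) ^ u j)}"
    using assms by (intro exp_zero_prime_power_sums) auto
  then obtain f :: "nat \<Rightarrow> 'a poly fract" where "f \<in> exp_seq"
    "{n. \<exists>u. n = (\<Sum>j=1..m. c j * (p ^ k) ^ u j)} = {n. f n = 0}"
    unfolding exp_zero_def by blast
  then show ?thesis using dml_split_torus_exp_seq by simp
qed

end
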